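(* Let $V$ be an $n$-dimensional vector space over a finite field $\mathbb{F}_{q}$, let $\mathcal{G}_j(V)$ denote the family of $j$-dimensional subspaces of $V$, and define $f: \mathcal{G}_1(V) \rightarrow \mathbb{R}$ to be a weighting of the 1-dimensional subspaces such that $\sum_{v \in \mathcal{G}_1(V)} f(v) = 0$. If $n \geq 3k$, then there are at least $\begin{bmatrix} n-1 \\ k-1 \end{bmatrix}_q$ $k$-dimensional subspaces with nonnegative weight. Moreover, if equality holds, the family of $k$-dimensional subspaces with nonnegative weight is a star, $\left \{S \in \mathcal{G}_k(V) : \hat{v} \subset S \right \}$, on a fixed 1-dimensional subspace $\hat{v} \in \mathcal{G}_1(V)$.
   Context: The weight $f(S)$ of a general subspace $S \subset V$ is the sum of the weights of all the 1-dimensional subspaces it contains. For positive integers $a,k$, the Gaussian binomial coefficient is $\begin{bmatrix} a \\ k \end{bmatrix}_q = \prod_{0 \leq i < k} \frac{q^{a-i}-1}{q^{k-i}-1}$; it counts the $k$-dimensional subspaces of an $a$-dimensional space, and $\begin{bmatrix} n-1 \\ k-1 \end{bmatrix}_q$ is the number of $k$-dimensional subspaces of $V$ containing a fixed 1-dimensional subspace. *)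

theory Defs
  imports Complex_Main "HOL-Library.Cardinality"
begin

definition subspaces_of_dim ::
    "('a::field \<Rightarrow> 'b::ab_group_add \<Rightarrow> 'b) \<Rightarrow> nat \<Rightarrow> 'b set set" where
  "subspaces_of_dim scale j =
     {S. module.subspace scale S \<and> vector_space.dim scale S = j}"

definition subspace_weight ::
    "('a::field \<Rightarrow> 'b::ab_group_add \<Rightarrow> 'b) \<Rightarrow> ('b set \<Rightarrow> real) \<Rightarrow> 'b set \<Rightarrow> real" where
  "subspace_weight scale f S = (\<Sum>L | L \<in> subspaces_of_dim scale 1 \<and> L \<subseteq> S. f L)"

definition nonneg_subspaces ::
    "('a::field \<Rightarrow> 'b::ab_group_add \<Rightarrow> 'b) \<Rightarrow> ('b set \<Rightarrow> real) \<Rightarrow> nat \<Rightarrow> 'b set set" where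
  "nonneg_subspaces scale f k =
     {S \<in> subspaces_of_dim scale k. subspace_weight scale f S \<ge> 0}"

definition star ::
    "('a::field \<Rightarrow> 'b::ab_group_add \<Rightarrow> 'b) \<Rightarrow> nat \<Rightarrow> 'b set \<Rightarrow> 'b set set" where
  "star scale k v = {S \<in> subspaces_of_dim scale k. v \<subseteq> S}"

(* The truncated subtraction a - i is harmless: if a < k, the factor for i = a is 0,
   so the product is 0 as it should be. For k = 0 the empty product is 1. *)
definition gauss_binomial :: "nat \<Rightarrow> nat \<Rightarrow> nat \<Rightarrow> real" where
  "gauss_binomial q a k =
     (\<Prod>i<k. (real q ^ (a - i) - 1) / (real q ^ (k - i) - 1))"

end

theory Submission
  imports Defs "HOL-Analysis.Convex"
begin

text \<open>
  Write \<open>N\<close> for the size of a star, and suppose that no star consists of nonnegative \<open>k\<close>-spaces only, while at most \<open>N\<close> \<open>k\<close>-spaces are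
  nonnegative.

  First, let \<open>A\<close> be a negative \<open>k\<close>-space. The \<open>k\<close>-spaces disjoint from \<open>A\<close> carry a nonnegative total weight.
  If \<open>C\<close> is one of maximal weight, then summing the weights of these spaces with multiplicity
  \<open>|S \<inter> C|\<close> and comparing with their second moment shows that at least \<open>\<eta> (1 - \<epsilon>) N\<close> of them are nonnegative,
  for a constant \<open>\<eta> \<ge> 1/2\<close>. Since every point lies on some negative \<open>A\<close>, every point lies on at most about
  \<open>(1 - \<eta>) N\<close> nonnegative \<open>k\<close>-spaces.

  Secondly, let \<open>C\<close> have the maximal weight \<open>M\<close> among all \<open>k\<close>-spaces. Looking at the \<open>k\<close>-spaces disjoint from one
  of minimal weight \<open>-m\<close> gives \<open>m \<le> (1 + \<epsilon>) M\<close>, and the second moment then yields \<open>\<Sum> f\<^sup>2 \<le> (2 + \<epsilon>) M\<^sup>2\<close>. For a point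
  \<open>p\<close> of \<open>C\<close>, a random \<open>k\<close>-space through \<open>p\<close> has mean weight close to \<open>f p\<close> and small variance, so by the
  Cauchy-Schwarz inequality the proportion of nonnegative ones is bounded below in terms of \<open>f p / M\<close>.
  Summed over the points of \<open>C\<close>, whose values add up to \<open>M\<close>, this is incompatible with the degree bound of the
  first part.

  All sums run over vectors instead of points: a point has \<open>q - 1\<close> nonzero vectors, which accounts for the
  factors \<open>q - 1\<close>.
\<close>

section \<open>Numerical estimates\<close>

text \<open>The proportion \<open>\<eta>\<close>, as a function of \<open>z = q ^ k\<close>. For \<open>z = 4\<close> and \<open>z = 8\<close> the estimates leave so
  little room that \<open>1/2\<close> would not suffice in \<open>star_numeric\<close>, whereas \<open>3/5\<close> is too large for the crude bounds
  by which \<open>avoid_numeric\<close> treats all larger \<open>z\<close> uniformly when \<open>q = 2\<close>.\<close>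

definition avoid_const :: "real \<Rightarrow> real" where
  "avoid_const z = (if z \<le> 8 then 3/5 else 1/2)"

text \<open>For small powers of two, bounds that are uniform in \<open>z\<close> are too weak.
  \<open>star_numeric\<close> treats 4, 8 and 16 one by one, while \<open>avoid_numeric\<close> can
  merge 16 with the larger powers.\<close>

lemma prime_power_cases:
  fixes q :: real
  assumes "q = real n" "n \<ge> 2" "k \<ge> 2"
  obtains "q = 2" "q ^ k = 4" | "q = 2" "q ^ k = 8" | "q = 2" "q ^ k = 16" | "q = 2" "q ^ k \<ge> 32"
    | "q \<ge> 3" "q ^ k \<ge> 9" "q ^ k \<ge> q\<^sup>2"
proof (cases "n = 2")
  case True
  then have q: "q = 2" using assms by simp
  consider "k = 2" | "k = 3" | "k = 4" | "k \<ge> 5" using assms(3) by linarith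
  then show ?thesis
  proof cases
    case 4
    then have "(2::real) ^ 5 \<le> 2 ^ k" by (intro power_increasing) auto
    then show ?thesis using that(4) q by simp
  qed (use that q in auto)
next
  case False
  then have q: "q \<ge> 3" using assms by simp
  then have "q ^ 2 \<le> q ^ k" using assms by (intro power_increasing) auto
  moreover have "(3::real)\<^sup>2 \<le> q\<^sup>2" using q by (intro power_mono) auto
  ultimately show ?thesis using that(5) q by simp
qed

text \<open>Everything follows from \<open>\<rho> * z\<^sup>2 \<le> 1\<close>, which holds because
  \<open>(z - q) * z \<le> z\<^sup>2 - q\<close>. The assumed bound on \<open>\<rho>\<close> is the
  value of \<open>(z - q) / (q ^ dimension - z * q)\<close> at
  \<open>q ^ dimension = z ^ 3\<close>.\<close>

lemma ratio_bounds:
  fixes q z \<rho> :: real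
  assumes "q \<ge> 2" "z \<ge> q\<^sup>2" "0 \<le> \<rho>" "\<rho> \<le> (z - q) / (z * (z\<^sup>2 - q))"
  shows "\<rho> * z \<le> 1 / z" "\<rho> * (z - 1) \<le> 1 / z" "(z - 1) * (z - q) * \<rho> \<le> 1"
    "\<rho> \<le> 1 / z\<^sup>2"
proof -
  have z4: "z \<ge> 4" using assms power_mono[of 2 q 2] by simp
  have "q * 2 \<le> q * q" using assms by (intro mult_left_mono) auto
  then have zq: "z \<ge> 2 * q" using assms(2) by (simp add: power2_eq_square)
  have zz: "z\<^sup>2 \<ge> 4 * z" using z4 by (simp add: power2_eq_square mult_right_mono)
  have pos: "z\<^sup>2 - q > 0" using zz zq assms by linarith
  have le: "\<rho> * (z * (z\<^sup>2 - q)) \<le> z - q" using assms(4) pos z4 by (simp add: pos_le_divide_eq)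
  have 1: "(z - q) * z \<le> z\<^sup>2 - q"
  proof -
    have "q * 1 \<le> q * z" using assms z4 by (intro mult_left_mono) auto
    then show ?thesis by (simp add: power2_eq_square algebra_simps)
  qed
  have a: "\<rho> * (z\<^sup>2 - q) * z\<^sup>2 \<le> 1 * (z\<^sup>2 - q)"
  proof -
    have "\<rho> * (z\<^sup>2 - q) * z\<^sup>2 = \<rho> * (z * (z\<^sup>2 - q)) * z" by (simp add: power2_eq_square)
    also have "\<dots> \<le> (z - q) * z" using le z4 by (intro mult_right_mono) auto
    finally show ?thesis using 1 by simp
  qed
  have "\<rho> * z\<^sup>2 * (z\<^sup>2 - q) \<le> 1 * (z\<^sup>2 - q)" using a by (simp add: mult_ac)
  then have b: "\<rho> * z\<^sup>2 \<le> 1" using pos mult_le_cancel_right_pos by blast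
  then show "\<rho> * z \<le> 1 / z" using z4 by (simp add: pos_le_divide_eq power2_eq_square mult_ac)
  then show "\<rho> * (z - 1) \<le> 1 / z" using assms(3) by (smt (verit) mult_left_mono)
  show "\<rho> \<le> 1 / z\<^sup>2" using b z4 by (simp add: pos_le_divide_eq)
  have "(z - 1) * (z - q) \<le> z\<^sup>2"
  proof -
    have "(z - 1) * (z - q) \<le> z * z" using z4 zq assms by (intro mult_mono) auto
    then show ?thesis by (simp add: power2_eq_square)
  qed
  then have "(z - 1) * (z - q) * \<rho> \<le> z\<^sup>2 * \<rho>" using assms(3) by (rule mult_right_mono)
  then show "(z - 1) * (z - q) * \<rho> \<le> 1" using b by (simp add: mult.commute)
qed

text \<open>Here \<open>Q = (z - 1) / (q - 1)\<close> is the number of points of a \<open>k\<close>-space.\<close>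

lemma avoid_numeric:
  fixes q z \<rho> :: real
  assumes q: "q = real n" "n \<ge> 2" and k: "k \<ge> 2" and z: "z = q ^ k"
    and \<rho>: "0 \<le> \<rho>" "\<rho> \<le> (z - q) / (z * (z\<^sup>2 - q))"
    and Q: "Q = (z - 1) / (q - 1)"
    and T: "T = 1 - (z - 1) * (z - q) * \<rho> / ((q - 1) * (q\<^sup>2 - 1)) - avoid_const z"
  obtains v where "T > 0" "v \<ge> 0" "\<rho>\<^sup>2 * z * Q\<^sup>2 \<le> T\<^sup>2 * v\<^sup>2"
    "avoid_const z * (\<rho>\<^sup>2 * z * Q / T\<^sup>2 + v) < 1 - \<rho> * z"
proof -
  note result = that
  \<comment> \<open>A lower bound \<open>T0\<close> may replace \<open>T\<close>; then
    \<open>u\<close> bounds \<open>\<rho>\<^sup>2 * z * Q / T\<^sup>2\<close> and \<open>w\<close>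
    bounds \<open>\<rho> * z\<close>, so that each case becomes a comparison of rational numbers. In
    the application, \<open>v\<close> bounds the quotient \<open>M * m / B\<close>.\<close>
  have reduce: thesis
    if e: "avoid_const z = \<eta>" "\<eta> \<ge> 0" and T0: "T \<ge> T0" "T0 > 0" and v: "v \<ge> 0" "Q \<ge> 0" "z \<ge> 0"
      and a: "\<rho>\<^sup>2 * z * Q\<^sup>2 \<le> T0\<^sup>2 * v\<^sup>2" and b: "\<rho>\<^sup>2 * z * Q \<le> u * T0\<^sup>2" 
      and c: "\<eta> * (u + v) < 1 - w" "\<rho> * z \<le> w" for \<eta> T0 v u w
  proof -
    have T: "T > 0" "T0\<^sup>2 \<le> T\<^sup>2" using T0 by (auto intro: power_mono)
    have "\<rho>\<^sup>2 * z * Q \<ge> 0" using v by simp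
    then have "u \<ge> 0" using b T0 by (smt (verit) mult_neg_pos zero_less_power)
    then have "\<rho>\<^sup>2 * z * Q \<le> u * T\<^sup>2" using b T mult_left_mono[of "T0\<^sup>2" "T\<^sup>2" u] by linarith
    then have "\<rho>\<^sup>2 * z * Q / T\<^sup>2 \<le> u" using T by (simp add: pos_divide_le_eq)
    then have "\<eta> * (\<rho>\<^sup>2 * z * Q / T\<^sup>2 + v) \<le> \<eta> * (u + v)" using e by (intro mult_left_mono) auto
    then have "avoid_const z * (\<rho>\<^sup>2 * z * Q / T\<^sup>2 + v) < 1 - \<rho> * z" using c unfolding e(1) by linarith
    moreover have "\<rho>\<^sup>2 * z * Q\<^sup>2 \<le> T\<^sup>2 * v\<^sup>2" using a T mult_right_mono[of "T0\<^sup>2" "T\<^sup>2" "v\<^sup>2"] by simp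
    ultimately show thesis using T(1) v(1) by (intro result)
  qed
  have sq: "\<rho>\<^sup>2 \<le> r\<^sup>2" if "\<rho> \<le> r" for r using \<rho> that by (intro power_mono) auto
  show thesis
  proof (rule prime_power_cases[OF q k])
    assume c: "q = 2" "q ^ k = 4"
    then have "z = 4" using z by simp
    then have r: "\<rho> \<le> 1/28" using \<rho> c by simp
    have Q': "Q = 3" and T': "T = 2/5 - 2 * \<rho>" and eta: "avoid_const z = 3/5"
      using Q T c \<open>z = 4\<close> by (auto simp: avoid_const_def)
    \<comment> \<open>The constant \<open>46/140\<close> is \<open>2/5 - 2 * (1/28)\<close>, the
      lower bound for \<open>T\<close>; the other two are roundings of the resulting
      \<open>v\<close> and \<open>u\<close>.\<close>
    have a: "\<rho>\<^sup>2 * z * Q\<^sup>2 \<le> (46/140)\<^sup>2 * (7/10)\<^sup>2" and b: "\<rho>\<^sup>2 * z * Q \<le> 3/20 * (46/140)\<^sup>2"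
      using sq[OF r] by (simp_all add: Q' \<open>z = 4\<close> power_divide)
    show thesis
      by (rule reduce[OF eta _ _ _ _ _ _ a b, of "1/7"]) (use r T' Q' \<open>z = 4\<close> in auto)
  next
    assume c: "q = 2" "q ^ k = 8"
    then have "z = 8" using z by simp
    then have r: "\<rho> \<le> 3/248" using \<rho> c by simp
    have Q': "Q = 7" and T': "T = 2/5 - 14 * \<rho>" and eta: "avoid_const z = 3/5"
      using Q T c \<open>z = 8\<close> by (auto simp: avoid_const_def)
    have a: "\<rho>\<^sup>2 * z * Q\<^sup>2 \<le> (23/100)\<^sup>2 * (11/10)\<^sup>2" and b: "\<rho>\<^sup>2 * z * Q \<le> 16/100 * (23/100)\<^sup>2"
      using sq[OF r] by (simp_all add: Q' \<open>z = 8\<close> power_divide)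
    show thesis
      by (rule reduce[OF eta _ _ _ _ _ _ a b, of "1/10"]) (use r T' Q' \<open>z = 8\<close> in auto)
  next
    have gen: thesis if c: "q = 2" "z \<ge> 16"
    proof -
      have zq: "z \<ge> q\<^sup>2" "q \<ge> 2" using c by auto
      note rb = ratio_bounds[OF zq(2) zq(1) \<rho>]
      have Q': "Q = z - 1" "Q \<ge> 0" using Q c by auto
      have eta: "avoid_const z = 1/2" using c by (simp add: avoid_const_def)
      have "T = 1/2 - (z - 1) * (z - 2) * \<rho> / 3" using T c eta by simp
      moreover have "(z - 1) * (z - 2) * \<rho> \<le> 1" using rb(3) c by simp
      ultimately have T16: "T \<ge> 1/6" by linarith
      have "1 / z \<le> 1/16" using c by simp
      have x: "\<rho> * Q \<le> 1 / z" "\<rho> * Q \<ge> 0" using rb(2) Q' \<rho> by auto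
      have "\<rho>\<^sup>2 * z * Q\<^sup>2 = (\<rho> * Q)\<^sup>2 * z" by (simp add: power_mult_distrib)
      also have "\<dots> \<le> (1 / z)\<^sup>2 * z" using x c by (intro mult_right_mono power_mono) auto
      also have "\<dots> = 1 / z" using c by (simp add: power2_eq_square)
      \<comment> \<open>There is no slack here: \<open>(1/6)\<^sup>2 * (3/2)\<^sup>2\<close> equals
        \<open>1/16\<close>, so \<open>v = 3/2\<close> is the least choice with these
        bounds.\<close>
      finally have a: "\<rho>\<^sup>2 * z * Q\<^sup>2 \<le> (1/6)\<^sup>2 * (3/2)\<^sup>2" using \<open>1 / z \<le> 1/16\<close> by (simp add: power2_eq_square)
      have "\<rho>\<^sup>2 * z * Q = (\<rho> * Q) * (\<rho> * z)" by (simp add: power2_eq_square)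
      also have "\<dots> \<le> (1/16) * (1/16)"
      proof (intro mult_mono)
        show "\<rho> * Q \<le> 1/16" "\<rho> * z \<le> 1/16" using x(1) rb(1) \<open>1 / z \<le> 1/16\<close> by linarith+
      qed (use \<rho> c in auto)
      finally have b: "\<rho>\<^sup>2 * z * Q \<le> 15/100 * (1/6)\<^sup>2" by (simp add: power2_eq_square)
      have w: "\<rho> * z \<le> 1/16" using rb(1) \<open>1 / z \<le> 1/16\<close> by linarith
      show thesis
        by (rule reduce[OF eta _ T16 _ _ Q'(2) _ a b _ w]) (use c in auto)
    qed
    { assume "q = 2" "q ^ k = 16" then show thesis using gen z by simp }
    { assume "q = 2" "q ^ k \<ge> 32" then show thesis using gen z by simp }
  next
    assume c: "q \<ge> 3" "q ^ k \<ge> 9" "q ^ k \<ge> q\<^sup>2"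
    then have zq: "z \<ge> q\<^sup>2" "q \<ge> 2" and z9: "z \<ge> 9" using z by auto
    note rb = ratio_bounds[OF zq(2) zq(1) \<rho>]
    have eta: "avoid_const z = 1/2" using z9 by (simp add: avoid_const_def)
    have Q0: "Q \<ge> 0" using Q c z9 by simp
    have q28: "q\<^sup>2 - 1 \<ge> 8" using power_mono[of 3 q 2] c by simp
    \<comment> \<open>The denominator is at least 16, whence
      \<open>T \<ge> 1 - 1/16 - 1/2 = 7/16\<close>.\<close>
    have "(q - 1) * (q\<^sup>2 - 1) \<ge> 2 * 8" using q28 c by (intro mult_mono) auto
    then have "(z - 1) * (z - q) * \<rho> / ((q - 1) * (q\<^sup>2 - 1)) \<le> 1 / 16"
      using rb(3) by (intro frac_le) auto
    then have T7: "T \<ge> 7/16" unfolding T eta by linarith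
    have "1 / z \<le> 1/9" using z9 by simp
    have x: "\<rho> * Q \<le> 1 / z / 2" "\<rho> * Q \<ge> 0"
    proof -
      have "\<rho> * Q = \<rho> * (z - 1) / (q - 1)" by (simp add: Q)
      also have "\<dots> \<le> 1 / z / 2" using rb(2) c z9 by (intro frac_le) auto
      finally show "\<rho> * Q \<le> 1 / z / 2" .
    qed (use \<rho> Q0 in auto)
    have "\<rho>\<^sup>2 * z * Q\<^sup>2 = (\<rho> * Q)\<^sup>2 * z" by (simp add: power_mult_distrib)
    also have "\<dots> \<le> (1 / z / 2)\<^sup>2 * z" using x z9 by (intro mult_right_mono power_mono) auto
    also have "\<dots> = 1 / z / 4" using z9 by (simp add: power2_eq_square)
    finally have a: "\<rho>\<^sup>2 * z * Q\<^sup>2 \<le> (7/16)\<^sup>2 * (2/5)\<^sup>2" using \<open>1 / z \<le> 1/9\<close> by (simp add: power2_eq_square)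
    have "\<rho>\<^sup>2 * z * Q = (\<rho> * Q) * (\<rho> * z)" by (simp add: power2_eq_square)
    also have "\<dots> \<le> (1/18) * (1/9)"
    proof (intro mult_mono)
      show "\<rho> * Q \<le> 1/18"
        using order_trans[OF x(1) divide_right_mono[OF \<open>1 / z \<le> 1/9\<close>, of 2]] by simp
      show "\<rho> * z \<le> 1/9" using rb(1) \<open>1 / z \<le> 1/9\<close> by linarith
    qed (use \<rho> z9 in auto)
    finally have b: "\<rho>\<^sup>2 * z * Q \<le> 4/100 * (7/16)\<^sup>2" by (simp add: power2_eq_square)
    have w: "\<rho> * z \<le> 1/9" using rb(1) \<open>1 / z \<le> 1/9\<close> by linarith
    show thesis
      by (rule reduce[OF eta _ T7 _ _ Q0 _ a b _ w]) (use z9 in auto)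
  qed
qed

text \<open>Since \<open>z * (z\<^sup>2 - q) \<le> z ^ 3 - q\<close>, the ratio belonging to all
  \<open>k\<close>-spaces is at most the one belonging to the \<open>k\<close>-spaces disjoint from
  a \<open>k\<close>-space. This makes \<open>ratio_bounds\<close> available to
  \<open>star_numeric\<close>.\<close>

lemma ratio_le:
  fixes q z :: real
  assumes "q \<ge> 2" "z \<ge> q\<^sup>2"
  shows "(z - q) / (z ^ 3 - q) \<le> (z - q) / (z * (z\<^sup>2 - q))"
proof -
  have z4: "z \<ge> 4" using assms power_mono[of 2 q 2] by simp
  have zq: "z \<ge> q" using assms self_le_power[of q 2] by simp
  have "q * 1 \<le> q * z" using assms z4 by (intro mult_left_mono) auto
  then have le: "z * (z\<^sup>2 - q) \<le> z ^ 3 - q" by (simp add: power2_eq_square power3_eq_cube algebra_simps)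
  have "1 * z < z * z" using z4 by (intro mult_strict_right_mono) auto
  then have "z\<^sup>2 - q > 0" using zq by (simp add: power2_eq_square)
  then have "z * (z\<^sup>2 - q) > 0" using z4 by simp
  then show ?thesis using le zq by (intro frac_le) auto
qed

text \<open>The inequality that the final contradiction needs. \<open>\<theta>\<close> stands for
  the proportion of the \<open>k\<close>-spaces through a point outside a \<open>k\<close>-space
  \<open>A\<close> that are disjoint from \<open>A\<close>. The first summand in the inner
  parentheses comes from the variance, the second from the degree bound, and
  \<open>1 + \<kappa>\<close> from the sum of the degrees along a \<open>k\<close>-space.\<close>

lemma star_numeric:
  fixes q z \<rho> :: real
  assumes q: "q = real n" "n \<ge> 2" and k: "k \<ge> 2" and z: "z = q ^ k"
    and \<rho>: "0 \<le> \<rho>" "\<rho> \<le> (z - q) / (z ^ 3 - q)"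
    and Q: "Q = (z - 1) / (q - 1)"
    and \<kappa>: "\<kappa> = (z - 1) * (z - q) * \<rho> / ((q - 1) * (q\<^sup>2 - 1))"
    and \<theta>: "1 - Q * \<rho> \<le> \<theta>"
  shows "0 < \<theta>" "(1 + \<kappa>) * (Q * \<rho> * q * (1 + 1 / \<theta>) / (1 - \<rho>)\<^sup>2 + (1 - avoid_const z * \<theta>)) < 1 - \<rho>"
proof -
  \<comment> \<open>The left side grows with \<open>\<kappa>\<close>, \<open>Q * \<rho> * q\<close>
    and \<open>\<rho>\<close> and falls with \<open>\<theta>\<close>, so it suffices to insert the
    upper bounds \<open>\<kappa>0\<close>, \<open>f\<close>, \<open>r\<close> and the lower bound
    \<open>1 - e\<close> for \<open>\<theta>\<close>.\<close>
  have reduce: "0 < \<theta> \<and> (1 + \<kappa>) * (Q * \<rho> * q * (1 + 1 / \<theta>) / (1 - \<rho>)\<^sup>2 + (1 - avoid_const z * \<theta>)) < 1 - \<rho>"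
    if \<kappa>0: "0 \<le> \<kappa>" "\<kappa> \<le> \<kappa>0" and e: "Q * \<rho> \<le> e" "0 \<le> e" "e < 1" and f: "0 \<le> Q * \<rho> * q" "Q * \<rho> * q \<le> f"
      and r: "\<rho> \<le> r" "r < 1" and et: "avoid_const z = \<eta>" "\<eta> \<ge> 0" "\<eta> \<le> 1"
      and c: "(1 + \<kappa>0) * (f * (1 + 1 / (1 - e)) / (1 - r)\<^sup>2 + (1 - \<eta> * (1 - e))) < 1 - r"
    for \<kappa>0 e f r \<eta>
  proof -
    have \<theta>': "\<theta> \<ge> 1 - e" "\<theta> > 0" using \<theta> e by auto
    have "1 / \<theta> \<le> 1 / (1 - e)" using \<theta>' e by (intro frac_le) auto
    moreover have "0 < 1 / \<theta>" using \<theta>' by simp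
    ultimately have "Q * \<rho> * q * (1 + 1 / \<theta>) \<le> f * (1 + 1 / (1 - e))"
      using f by (intro mult_mono) auto
    moreover have "(1 - r)\<^sup>2 \<le> (1 - \<rho>)\<^sup>2" using r by (intro power_mono) auto
    moreover have "0 \<le> f * (1 + 1 / (1 - e))" using f e by (intro mult_nonneg_nonneg) auto
    ultimately have 1: "Q * \<rho> * q * (1 + 1 / \<theta>) / (1 - \<rho>)\<^sup>2 \<le> f * (1 + 1 / (1 - e)) / (1 - r)\<^sup>2"
      using r by (intro frac_le) auto
    have 2: "1 - \<eta> * \<theta> \<le> 1 - \<eta> * (1 - e)" using et \<theta>' by (simp add: mult_left_mono)
    have 0: "0 \<le> f * (1 + 1 / (1 - e)) / (1 - r)\<^sup>2" using \<open>0 \<le> f * _\<close> by simp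
    have "\<eta> * (1 - e) \<le> 1 * 1" using et e by (intro mult_mono) auto
    then have 3: "0 \<le> f * (1 + 1 / (1 - e)) / (1 - r)\<^sup>2 + (1 - \<eta> * (1 - e))" using 0 by linarith
    have "(1 + \<kappa>) * (Q * \<rho> * q * (1 + 1 / \<theta>) / (1 - \<rho>)\<^sup>2 + (1 - \<eta> * \<theta>))
        \<le> (1 + \<kappa>) * (f * (1 + 1 / (1 - e)) / (1 - r)\<^sup>2 + (1 - \<eta> * (1 - e)))"
      using 1 2 \<kappa>0 by (intro mult_left_mono) auto
    also have "\<dots> \<le> (1 + \<kappa>0) * (f * (1 + 1 / (1 - e)) / (1 - r)\<^sup>2 + (1 - \<eta> * (1 - e)))"
      using 3 \<kappa>0 by (intro mult_right_mono) auto
    finally show ?thesis using c r et \<theta>' by simp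
  qed
  have "0 < \<theta> \<and> (1 + \<kappa>) * (Q * \<rho> * q * (1 + 1 / \<theta>) / (1 - \<rho>)\<^sup>2 + (1 - avoid_const z * \<theta>)) < 1 - \<rho>"
  proof (rule prime_power_cases[OF q k])
    assume c: "q = 2" "q ^ k = 4"
    then have z4: "z = 4" using z by simp
    then have r: "\<rho> \<le> 1/31" using \<rho> c by simp
    \<comment> \<open>The arguments are the values of \<open>\<kappa>\<close>,
      \<open>Q * \<rho>\<close>, \<open>Q * \<rho> * q\<close> and \<open>\<rho>\<close> at the
      extreme value \<open>\<rho> = 1/31\<close>; the next two cases proceed likewise with
      \<open>1/85\<close> and \<open>7/2047\<close>.\<close>
    show ?thesis
      by (rule reduce[of "2/31" "3/31" "6/31" "1/31" "3/5"])
        (use r \<rho> \<kappa> Q c z4 in \<open>auto simp: avoid_const_def power2_eq_square\<close>)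
  next
    assume c: "q = 2" "q ^ k = 8"
    then have z4: "z = 8" using z by simp
    then have r: "\<rho> \<le> 1/85" using \<rho> c by simp
    show ?thesis
      by (rule reduce[of "14/85" "7/85" "14/85" "1/85" "3/5"])
        (use r \<rho> \<kappa> Q c z4 in \<open>auto simp: avoid_const_def power2_eq_square\<close>)
  next
    assume c: "q = 2" "q ^ k = 16"
    then have z4: "z = 16" using z by simp
    then have r: "\<rho> \<le> 7/2047" using \<rho> c by simp
    show ?thesis
      by (rule reduce[of "490/2047" "105/2047" "210/2047" "7/2047" "1/2"])
        (use r \<rho> \<kappa> Q c z4 in \<open>auto simp: avoid_const_def power2_eq_square\<close>)
  next
    assume c: "q = 2" "q ^ k \<ge> 32"
    then have z4: "z \<ge> 32" using z by simp
    have "\<rho> \<le> (z - q) / (z * (z\<^sup>2 - q))"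
      using \<rho>(2) ratio_le[of q z] c z4 by simp
    note rb = ratio_bounds[OF _ _ \<rho>(1) this]
    have rb: "\<rho> * (z - 1) \<le> 1 / z" "(z - 1) * (z - q) * \<rho> \<le> 1" "\<rho> \<le> 1 / z\<^sup>2"
      using rb c z4 by auto
    have zi: "1 / z \<le> 1 / 32" "1 / z\<^sup>2 \<le> 1 / 1024"
      using z4 power_mono[of 32 z 2] by (auto simp: field_simps)
    have \<kappa>': "\<kappa> = (z - 1) * (z - q) * \<rho> / 3" using \<kappa> c by simp
    have 1: "0 \<le> \<kappa>" unfolding \<kappa>' using z4 c \<rho> by simp
    have 2: "\<kappa> \<le> 1/3" using \<kappa>' rb(2) by linarith
    have "Q = z - 1" using Q c by simp
    then have 3: "Q * \<rho> \<le> 1/32" "0 \<le> Q * \<rho>"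
      using order_trans[OF rb(1) zi(1)] z4 \<rho> by (simp_all add: mult.commute)
    have 4: "\<rho> \<le> 1/1024" using rb(3) zi(2) by linarith
    show ?thesis
      by (rule reduce[OF 1 2 3(1) _ _ _ _ 4, of "1/16" "1/2"])
        (use 3 c z4 in \<open>auto simp: avoid_const_def power2_eq_square\<close>)
  next
    assume c: "q \<ge> 3" "q ^ k \<ge> 9" "q ^ k \<ge> q\<^sup>2"
    then have zq: "z \<ge> q\<^sup>2" "q \<ge> 2" and z9: "z \<ge> 9" using z by auto
    have zq2: "z \<ge> q" using zq self_le_power[of q 2] by simp
    have "\<rho> \<le> (z - q) / (z * (z\<^sup>2 - q))"
      using \<rho>(2) ratio_le[OF zq(2,1)] by simp
    note rb = ratio_bounds[OF zq(2) zq(1) \<rho>(1) this]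
    have zi: "1 / z \<le> 1 / 9" "1 / z\<^sup>2 \<le> 1 / 81"
      using z9 power_mono[of 9 z 2] by (auto simp: field_simps)
    have q28: "q\<^sup>2 - 1 \<ge> 8" using power_mono[of 3 q 2] c by simp
    have "(q - 1) * (q\<^sup>2 - 1) \<ge> 2 * 8" using q28 c by (intro mult_mono) auto
    then have k1: "\<kappa> \<le> 1 / 16" "0 \<le> \<kappa>" unfolding \<kappa>
      using rb(3) z9 zq2 \<rho> q28 c by (auto intro!: frac_le divide_nonneg_nonneg mult_nonneg_nonneg)
    have e: "Q * \<rho> \<le> 1/18"
    proof -
      have "Q * \<rho> = \<rho> * (z - 1) / (q - 1)" by (simp add: Q)
      also have "\<dots> \<le> (1/9) / 2" using order_trans[OF rb(2) zi(1)] c z9 by (intro frac_le) auto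
      finally show ?thesis by simp
    qed
    have f: "Q * \<rho> * q \<le> 1/6"
    proof -
      have "Q * \<rho> * q = \<rho> * (z - 1) * (q / (q - 1))" by (simp add: Q)
      also have "\<dots> \<le> 1/9 * (3/2)" using order_trans[OF rb(2) zi(1)] c z9 \<rho> by (intro mult_mono) (auto simp: field_simps)
      finally show ?thesis by simp
    qed
    show ?thesis
      by (rule reduce[of "1/16" "1/18" "1/6" "1/81" "1/2"])
        (use order_trans[OF rb(4) zi(2)] k1 e f \<rho> Q c z9 in \<open>auto simp: avoid_const_def power2_eq_square\<close>)
  qed
  then show "0 < \<theta>" "(1 + \<kappa>) * (Q * \<rho> * q * (1 + 1 / \<theta>) / (1 - \<rho>)\<^sup>2 + (1 - avoid_const z * \<theta>)) < 1 - \<rho>"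
    by auto
qed

text \<open>For positive arguments, \<open>s * (s - \<beta>)\<close> is nonpositive up to
  \<open>\<beta>\<close> and increasing from there on. The quadratic bound therefore passes from a
  sum that is known only from below to its lower bound.\<close>

lemma quadratic_le_at_smaller:
  fixes s s0 \<alpha> \<beta> :: real
  assumes "s\<^sup>2 \<le> \<alpha> + \<beta> * s" "0 < s0" "s0 \<le> s" "0 \<le> \<alpha>"
  shows "s0\<^sup>2 \<le> \<alpha> + \<beta> * s0"
proof (cases "s0 \<le> \<beta>")
  case True
  then have "s0 * s0 \<le> \<beta> * s0" using assms by (intro mult_right_mono) auto
  then show ?thesis unfolding power2_eq_square using assms(4) by linarith
next
  case False
  then have "s0 * (s0 - \<beta>) \<le> s * (s - \<beta>)" using assms by (intro mult_mono) auto
  then show ?thesis using assms by (simp add: power2_eq_square algebra_simps)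
qed

section \<open>Counting subspaces with prescribed intersection\<close>

locale finite_vector_space = finite_dimensional_vector_space scale Basis
  for scale :: "'a::{field,finite} \<Rightarrow> 'b::ab_group_add \<Rightarrow> 'b" (infixr "*s" 75)
    and Basis :: "'b set"
begin

section \<open>Cardinalities of spans and subspaces\<close>

definition q :: real where "q = real CARD('a)"

lemma q_ge_2: "q \<ge> 2"
proof -
  have "card {0, 1 :: 'a} \<le> CARD('a)" by (intro card_mono) auto
  then show ?thesis by (simp add: q_def)
qed

text \<open>Each vector of the larger span is \<open>c *s x + y\<close> for exactly one scalar
  \<open>c\<close> and one \<open>y\<close> in \<open>P\<close>.\<close>

lemma card_span_insert:
  assumes "subspace P" "finite P" "x \<notin> P"
  shows "finite (span (insert x P)) \<and> card (span (insert x P)) = CARD('a) * card P"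
proof -
  let ?h = "\<lambda>(c, y). c *s x + y"
  have sp: "span P = P" using assms(1) by (rule span_eq_iff[THEN iffD2])
  have inj: "inj_on ?h (UNIV \<times> P)"
  proof (rule inj_onI, clarify)
    fix c c' y y' assume y: "y \<in> P" "y' \<in> P" and e: "c *s x + y = c' *s x + y'"
    then have e': "(c - c') *s x = y' - y" by (simp add: algebra_simps scale_left_diff_distrib)
    have "c = c'"
    proof (rule ccontr)
      assume "c \<noteq> c'"
      then have "x = inverse (c - c') *s (y' - y)" by (simp add: e'[symmetric])
      also have "\<dots> \<in> P" using assms(1) y by (intro subspace_scale subspace_diff)
      finally show False using assms(3) by simp
    qed
    then show "c = c' \<and> y = y'" using e by simp
  qed
  have im: "?h ` (UNIV \<times> P) = span (insert x P)"
  proof (intro equalityI subsetI)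
    fix z assume "z \<in> ?h ` (UNIV \<times> P)"
    then obtain c y where "z = c *s x + y" "y \<in> P" by auto
    then have "z - c *s x \<in> span P" by (simp add: span_base)
    then show "z \<in> span (insert x P)" by (auto simp: span_breakdown_eq)
  next
    fix z assume "z \<in> span (insert x P)"
    then obtain c where "z - c *s x \<in> P" by (auto simp: span_breakdown_eq sp)
    then have "(c, z - c *s x) \<in> UNIV \<times> P" "z = ?h (c, z - c *s x)" by auto
    then show "z \<in> ?h ` (UNIV \<times> P)" by (rule rev_image_eqI)
  qed
  show ?thesis using inj im assms(2) finite_imageI[of "UNIV \<times> P" ?h] card_image[OF inj]
    by (simp add: card_cartesian_product)
qed

lemma card_span_independent:
  assumes "finite B" "independent B"
  shows "finite (span B) \<and> card (span B) = CARD('a) ^ card B"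
  using assms
proof (induction rule: finite_induct)
  case empty
  then show ?case by simp
next
  case (insert x B)
  then have "independent B" "x \<notin> span B" by (auto simp: independent_insert)
  moreover have "span (insert x (span B)) = span (insert x B)"
    by (simp add: set_eq_iff span_breakdown_eq span_span)
  ultimately show ?case using insert card_span_insert[of "span B" x] by auto
qed

lemma finite_carrier: "finite (UNIV :: 'b set)"
  by (metis card_span_independent finite_Basis independent_Basis span_Basis)

lemma finite_subset_carrier [simp]: "finite (S :: 'b set)"
  using finite_carrier by (rule rev_finite_subset) simp

lemma finite_family [simp]: "finite (F :: 'b set set)"
  using finite_carrier by (metis finite_Pow_iff Pow_UNIV rev_finite_subset subset_UNIV)

lemma card_subspace:
  assumes "subspace S"
  shows "real (card S) = q ^ dim S"
proof -
  obtain B where B: "B \<subseteq> S" "independent B" "S \<subseteq> span B" "card B = dim S"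
    using basis_exists by blast
  then have "span B = S" using assms by (metis span_subspace)
  then show ?thesis using card_span_independent[of B] B finiteI_independent[of B] by (simp add: q_def)
qed

lemma dim_insert_subspace:
  assumes "subspace S" "x \<notin> S"
  shows "dim (insert x S) = Suc (dim S)"
  using assms by (simp add: dim_insert span_eq_iff[THEN iffD2])

lemma span_insert_subspace:
  assumes "subspace S" 
  shows "y \<in> span (insert x S) \<longleftrightarrow> (\<exists>c. y - c *s x \<in> S)"
  using assms by (simp add: span_breakdown_eq span_eq_iff[THEN iffD2])

section \<open>Recursive counting by adjoining a vector\<close>

text \<open>One notion covers all families that occur: \<open>P = {0}\<close> and
  \<open>Q = A\<close> gives the \<open>k\<close>-spaces disjoint from \<open>A\<close>,
  \<open>P = Q\<close> the \<open>k\<close>-spaces containing \<open>P\<close>, and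
  \<open>P = Q = {0}\<close> all \<open>k\<close>-spaces.\<close>

definition meeting :: "nat \<Rightarrow> 'b set \<Rightarrow> 'b set \<Rightarrow> 'b set set" where
  "meeting k P Q = {S. subspace S \<and> dim S = k \<and> S \<inter> Q = P}"

text \<open>The size of \<open>meeting k P Q\<close> for \<open>P \<subseteq> Q\<close> of
  dimensions \<open>j\<close> and \<open>j + t\<close>. The numerators count the ways to extend
  \<open>P\<close> vector by vector outside the span of \<open>Q\<close> and the vectors chosen so
  far, the denominators the ways that lead to a fixed \<open>k\<close>-space. The value 0 for
  \<open>k < j\<close> has to be set explicitly, since the empty product would give 1.\<close>

definition meet_count :: "nat \<Rightarrow> nat \<Rightarrow> nat \<Rightarrow> real" where
  "meet_count k j t = (if k < j then 0 else
     (\<Prod>i=j..<k. (q ^ dimension - q ^ (i + t)) / (q ^ k - q ^ i)))"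

lemma meet_count_rec:
  assumes "j \<le> k"
  shows "meet_count k j t * (q ^ k - q ^ j) = (q ^ dimension - q ^ (j + t)) * meet_count k (Suc j) t"
proof (cases "j = k")
  case True
  then show ?thesis by (simp add: meet_count_def)
next
  case False
  then have "j < k" using assms by simp
  then have "q ^ j < q ^ k" using q_ge_2 by (intro power_strict_increasing) auto
  then show ?thesis using \<open>j < k\<close>
    by (simp add: meet_count_def prod.atLeast_Suc_lessThan divide_simps)
qed

text \<open>Prescribing a vector outside \<open>Q\<close> amounts to adjoining it to both
  \<open>P\<close> and \<open>Q\<close>, which raises \<open>j\<close> by one and keeps
  \<open>t\<close>. If \<open>y - c *s x\<close> is in \<open>Q\<close> with \<open>x\<close> and
  \<open>y\<close> in \<open>S\<close>, then it is in \<open>S \<inter> Q = P\<close>; conversely, a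
  vector of \<open>Q\<close> in the span of \<open>x\<close> and \<open>P\<close> has coefficient 0
  at \<open>x\<close>, because \<open>x\<close> is not in \<open>Q\<close>.\<close>

lemma meeting_insert:
  assumes P: "subspace P" and Q: "subspace Q" and "P \<subseteq> Q" "x \<notin> Q"
  shows "{S \<in> meeting k P Q. x \<in> S} = meeting k (span (insert x P)) (span (insert x Q))"
proof (intro equalityI subsetI)
  fix S assume "S \<in> {S \<in> meeting k P Q. x \<in> S}"
  then have S: "subspace S" "dim S = k" "S \<inter> Q = P" "x \<in> S" by (auto simp: meeting_def)
  have "S \<inter> span (insert x Q) = span (insert x P)"
  proof (intro equalityI subsetI)
    fix y assume y: "y \<in> S \<inter> span (insert x Q)"
    then obtain c where c: "y - c *s x \<in> Q" by (auto simp: span_insert_subspace Q)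
    have "y - c *s x \<in> S" using y S by (intro subspace_diff subspace_scale) auto
    then show "y \<in> span (insert x P)" using c S by (auto simp: span_insert_subspace P)
  next
    fix y assume "y \<in> span (insert x P)"
    then obtain c where c: "y - c *s x \<in> P" by (auto simp: span_insert_subspace P)
    then have "y - c *s x + c *s x \<in> S" using S by (intro subspace_add subspace_scale) auto
    then show "y \<in> S \<inter> span (insert x Q)" using c assms by (auto simp: span_insert_subspace Q)
  qed
  then show "S \<in> meeting k (span (insert x P)) (span (insert x Q))" using S by (simp add: meeting_def)
next
  fix S assume "S \<in> meeting k (span (insert x P)) (span (insert x Q))"
  then have S: "subspace S" "dim S = k" and I: "S \<inter> span (insert x Q) = span (insert x P)"
    by (auto simp: meeting_def)
  have x: "x \<in> S" using I span_base[of x "insert x P"] by auto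
  have "S \<inter> Q = P"
  proof (intro equalityI subsetI)
    fix y assume y: "y \<in> S \<inter> Q"
    then have "y \<in> span (insert x Q)" by (simp add: span_base)
    then have "y \<in> span (insert x P)" using I y by auto
    then obtain c where c: "y - c *s x \<in> P" by (auto simp: span_insert_subspace P)
    have "c = 0"
    proof (rule ccontr)
      assume "c \<noteq> 0"
      have "y - (y - c *s x) \<in> Q" using c y assms(3) Q by (blast intro: subspace_diff)
      then have "c *s x \<in> Q" by simp
      then have "inverse c *s (c *s x) \<in> Q" using Q subspace_scale by blast
      then show False using \<open>c \<noteq> 0\<close> assms(4) by simp
    qed
    then show "y \<in> P" using c by simp
  next
    fix y assume y: "y \<in> P"
    then have "y \<in> S" using I span_base[of y "insert x P"] by auto
    then show "y \<in> S \<inter> Q" using y assms(3) by auto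
  qed
  then show "S \<in> {S \<in> meeting k P Q. x \<in> S}" using S x by (simp add: meeting_def)
qed

lemma real_card_eq_sum: "finite B \<Longrightarrow> A \<subseteq> B \<Longrightarrow> real (card A) = (\<Sum>x\<in>B. of_bool (x \<in> A))"
  by (simp add: Int_absorb1 sum.If_cases of_bool_def)

lemma sum_incidence_weighted:
  fixes h :: "'b \<Rightarrow> real"
  shows "(\<Sum>S\<in>(\<F> :: 'b set set). g S * (\<Sum>x\<in>S. h x)) = (\<Sum>x\<in>UNIV. h x * (\<Sum>S | S \<in> \<F> \<and> x \<in> S. g S))"
proof -
  have "(\<Sum>S\<in>\<F>. g S * (\<Sum>x\<in>S. h x)) = (\<Sum>S\<in>\<F>. \<Sum>x\<in>UNIV. if x \<in> S then h x * g S else 0)"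
    unfolding sum_distrib_left
    by (intro sum.cong refl sum.mono_neutral_cong_left) auto
  also have "\<dots> = (\<Sum>x\<in>UNIV. \<Sum>S\<in>\<F>. if x \<in> S then h x * g S else 0)" by (rule sum.swap)
  also have "\<dots> = (\<Sum>x\<in>UNIV. h x * (\<Sum>S | S \<in> \<F> \<and> x \<in> S. g S))"
    by (intro sum.cong refl) (simp add: sum_distrib_left sum.If_cases Int_def)
  finally show ?thesis .
qed

lemma sum_incidence:
  fixes h :: "'b \<Rightarrow> real"
  shows "(\<Sum>S\<in>(\<F> :: 'b set set). \<Sum>x\<in>S. h x) = (\<Sum>x\<in>UNIV. h x * real (card {S\<in>\<F>. x \<in> S}))"
  using sum_incidence_weighted[of "\<lambda>_. 1" h \<F>] by simp

text \<open>Double counting of the pairs of a member \<open>S\<close> and a vector of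
  \<open>S\<close> outside \<open>Q\<close>: each \<open>S\<close> has \<open>q ^ k - q ^ j\<close>
  such vectors, and each vector outside \<open>Q\<close> lies on
  \<open>meet_count k (Suc j) t\<close> members by induction. The measure \<open>Suc k - j\<close>
  reaches 0 when \<open>j > k\<close>, where the family is empty.\<close>

lemma card_meeting:
  assumes "subspace P" "subspace Q" "P \<subseteq> Q" "dim P = j" "dim Q = j + t"
  shows "real (card (meeting k P Q)) = meet_count k j t"
  using assms
proof (induction "Suc k - j" arbitrary: j P Q)
  case 0
  have "S \<notin> meeting k P Q" for S
  proof
    assume "S \<in> meeting k P Q"
    then have "dim P \<le> k" using dim_subset[of P S] by (auto simp: meeting_def)
    then show False using 0 by simp
  qed
  then have "meeting k P Q = {}" by blast
  moreover have "k < j" using 0 by simp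
  ultimately show ?case by (simp add: meet_count_def)
next
  case (Suc d)
  show ?case
  proof (cases "j = k")
    case True
    have "S = P" if "S \<in> meeting k P Q" for S
    proof -
      have S: "subspace S" "dim S = k" "P \<subseteq> S" using that by (auto simp: meeting_def)
      then show ?thesis using subspace_dim_equal[of P S] Suc.prems True by simp
    qed
    moreover have "P \<in> meeting k P Q" using Suc.prems True by (auto simp: meeting_def)
    ultimately have "meeting k P Q = {P}" by blast
    then show ?thesis using True by (simp add: meet_count_def)
  next
    case False
    then have jk: "j < k" using Suc by simp
    have IH: "real (card {S \<in> meeting k P Q. x \<in> S}) = meet_count k (Suc j) t" if "x \<notin> Q" for x
    proof -
      have "x \<notin> P" using that Suc.prems by auto
      have "real (card (meeting k (span (insert x P)) (span (insert x Q)))) = meet_count k (Suc j) t"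
        using Suc.prems that \<open>x \<notin> P\<close> Suc.hyps(2) jk
        by (intro Suc.hyps(1)) (auto simp: dim_insert_subspace intro!: span_mono)
      then show ?thesis using meeting_insert[of P Q x k] Suc.prems that by simp
    qed
    have "real (card (meeting k P Q)) * (q ^ k - q ^ j) = (\<Sum>S\<in>meeting k P Q. \<Sum>x\<in>S. of_bool (x \<notin> Q))"
    proof -
      have "(\<Sum>x\<in>S. of_bool (x \<notin> Q)) = q ^ k - q ^ j" if "S \<in> meeting k P Q" for S
      proof -
        have S: "subspace S" "dim S = k" "S \<inter> Q = P" using that by (auto simp: meeting_def)
        have "(\<Sum>x\<in>S. of_bool (x \<notin> Q)) = real (card (S - Q))"
          using real_card_eq_sum[of S "S - Q"] by simp
        also have "S - Q = S - P" using S by auto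
        also have "real (card (S - P)) = real (card S) - real (card P)"
          using S by (subst card_Diff_subset) (auto simp: of_nat_diff card_mono)
        finally show ?thesis using S Suc.prems by (simp add: card_subspace)
      qed
      then show ?thesis by simp
    qed
    also have "\<dots> = (\<Sum>x\<in>UNIV. of_bool (x \<notin> Q) * meet_count k (Suc j) t)"
      unfolding sum_incidence by (intro sum.cong refl) (simp add: IH of_bool_def)
    also have "\<dots> = real (card (UNIV - Q)) * meet_count k (Suc j) t"
      using real_card_eq_sum[of UNIV "UNIV - Q"] by (simp flip: sum_distrib_right)
    also have "real (card (UNIV - Q)) = q ^ dimension - q ^ (j + t)"
      using Suc.prems card_subspace[OF subspace_UNIV] card_subspace[of Q]
      by (subst card_Diff_subset) (auto simp: of_nat_diff card_mono finite_carrier dimension_def)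
    also have "\<dots> * meet_count k (Suc j) t = meet_count k j t * (q ^ k - q ^ j)"
      using meet_count_rec[of j k t] jk by simp
    finally show ?thesis using power_strict_increasing[of j k q] jk q_ge_2 by simp
  qed
qed

section \<open>Moments of subspace weights\<close>

lemma subspace_meeting: "S \<in> meeting k P Q \<Longrightarrow> subspace S"
  by (simp add: meeting_def)

text \<open>A vector of \<open>P\<close> lies on every member, one of \<open>Q - P\<close> on none,
  and one outside \<open>Q\<close> on \<open>meet_count k (Suc j) t\<close> of them.\<close>

lemma sum_meeting:
  fixes \<psi> :: "'b \<Rightarrow> real"
  assumes "subspace P" "subspace Q" "P \<subseteq> Q" "dim P = j" "dim Q = j + t"
  shows "(\<Sum>S\<in>meeting k P Q. sum \<psi> S) =
    meet_count k j t * sum \<psi> P + meet_count k (Suc j) t * (sum \<psi> UNIV - sum \<psi> Q)"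
proof -
  have "real (card {S\<in>meeting k P Q. x \<in> S}) =
      meet_count k j t * of_bool (x \<in> P) + meet_count k (Suc j) t * of_bool (x \<notin> Q)" for x
  proof (cases "x \<in> Q")
    case True
    then have "{S\<in>meeting k P Q. x \<in> S} = (if x \<in> P then meeting k P Q else {})"
      using assms(3) by (auto simp: meeting_def)
    then show ?thesis using True card_meeting[OF assms] by simp
  next
    case False
    then have "x \<notin> P" using assms(3) by auto
    have "real (card (meeting k (span (insert x P)) (span (insert x Q)))) = meet_count k (Suc j) t"
      using assms False \<open>x \<notin> P\<close> by (intro card_meeting) (auto simp: dim_insert_subspace intro!: span_mono)
    then show ?thesis using meeting_insert[OF assms(1-3) False] False \<open>x \<notin> P\<close> by simp
  qed
  then have "(\<Sum>S\<in>meeting k P Q. sum \<psi> S) =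
      (\<Sum>x\<in>UNIV. meet_count k j t * (of_bool (x \<in> P) * \<psi> x) + meet_count k (Suc j) t * (of_bool (x \<notin> Q) * \<psi> x))"
    by (simp add: sum_incidence algebra_simps)
  also have "\<dots> = meet_count k j t * (\<Sum>x\<in>UNIV. of_bool (x \<in> P) * \<psi> x)
      + meet_count k (Suc j) t * (\<Sum>x\<in>UNIV. of_bool (x \<notin> Q) * \<psi> x)"
    by (simp only: sum.distrib sum_distrib_left)
  also have "(\<Sum>x\<in>UNIV. of_bool (x \<in> P) * \<psi> x) = sum \<psi> P"
    by (rule sum.mono_neutral_cong_right) auto
  also have "(\<Sum>x\<in>UNIV. of_bool (x \<notin> Q) * \<psi> x) = sum \<psi> (UNIV - Q)"
    by (rule sum.mono_neutral_cong_right) auto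
  also have "\<dots> = sum \<psi> UNIV - sum \<psi> Q"
    by (rule sum_diff) auto
  finally show ?thesis .
qed

lemma sum_meeting_through:
  fixes \<psi> :: "'b \<Rightarrow> real"
  assumes "subspace P" "subspace Q" "P \<subseteq> Q" "dim P = j" "dim Q = j + t" "x \<notin> Q"
  shows "(\<Sum>S | S \<in> meeting k P Q \<and> x \<in> S. sum \<psi> S) =
    meet_count k (Suc j) t * sum \<psi> (span (insert x P))
    + meet_count k (Suc (Suc j)) t * (sum \<psi> UNIV - sum \<psi> (span (insert x Q)))"
proof -
  have "x \<notin> P" using assms by auto
  then show ?thesis
    unfolding meeting_insert[OF assms(1-3,6)]
    using assms by (intro sum_meeting) (auto simp: dim_insert_subspace intro!: span_mono)
qed

lemma card_meeting_through:
  assumes "subspace P" "subspace Q" "P \<subseteq> Q" "dim P = j" "dim Q = j + t" "x \<notin> Q"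
  shows "real (card {S \<in> meeting k P Q. x \<in> S}) = meet_count k (Suc j) t"
proof -
  have "x \<notin> P" using assms by auto
  then show ?thesis
    unfolding meeting_insert[OF assms(1-3,6)]
    using assms by (intro card_meeting) (auto simp: dim_insert_subspace intro!: span_mono)
qed

text \<open>One factor of each square is expanded over the vectors \<open>x\<close> of
  \<open>S\<close>; the other is then a first moment over the members through \<open>x\<close>. Only
  \<open>x\<close> outside \<open>Q\<close> contribute, as \<open>\<psi>\<close> vanishes on
  \<open>Q\<close>.\<close>

lemma second_moment_meeting:
  fixes \<psi> :: "'b \<Rightarrow> real"
  assumes "subspace P" "subspace Q" "P \<subseteq> Q" "dim P = j" "dim Q = j + t"
    and "\<And>x. x \<in> Q \<Longrightarrow> \<psi> x = 0"
  shows "(\<Sum>S\<in>meeting k P Q. (sum \<psi> S)\<^sup>2) =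
    meet_count k (Suc j) t * (\<Sum>x\<in>UNIV. \<psi> x * sum \<psi> (span (insert x P)))
    + meet_count k (Suc (Suc j)) t * ((sum \<psi> UNIV)\<^sup>2 - (\<Sum>x\<in>UNIV. \<psi> x * sum \<psi> (span (insert x Q))))"
proof -
  have "(\<Sum>S\<in>meeting k P Q. (sum \<psi> S)\<^sup>2) = (\<Sum>x\<in>UNIV. \<psi> x * (\<Sum>S | S \<in> meeting k P Q \<and> x \<in> S. sum \<psi> S))"
    using sum_incidence_weighted[of "sum \<psi>" \<psi> "meeting k P Q"] by (simp add: power2_eq_square)
  also have "\<dots> = (\<Sum>x\<in>UNIV. \<psi> x * (meet_count k (Suc j) t * sum \<psi> (span (insert x P))
    + meet_count k (Suc (Suc j)) t * (sum \<psi> UNIV - sum \<psi> (span (insert x Q)))))"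
  proof (intro sum.cong refl)
    fix x
    show "\<psi> x * (\<Sum>S | S \<in> meeting k P Q \<and> x \<in> S. sum \<psi> S) = \<psi> x * (meet_count k (Suc j) t * sum \<psi> (span (insert x P))
    + meet_count k (Suc (Suc j)) t * (sum \<psi> UNIV - sum \<psi> (span (insert x Q))))"
      using assms(6)[of x] sum_meeting_through[OF assms(1-5), of x \<psi> k] by (cases "x \<in> Q") simp_all
  qed
  also have "\<dots> = meet_count k (Suc j) t * (\<Sum>x\<in>UNIV. \<psi> x * sum \<psi> (span (insert x P)))
    + meet_count k (Suc (Suc j)) t * ((\<Sum>x\<in>UNIV. \<psi> x) * sum \<psi> UNIV - (\<Sum>x\<in>UNIV. \<psi> x * sum \<psi> (span (insert x Q))))"
  proof -
    have d: "\<psi> x * (a * u + b * (w - v)) = a * (\<psi> x * u) + b * (\<psi> x * w) - b * (\<psi> x * v)" for x a b u v w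
      by (simp add: algebra_simps)
    show ?thesis unfolding d sum_subtractf sum.distrib
      by (simp flip: sum_distrib_left sum_distrib_right add: right_diff_distrib)
  qed
  finally show ?thesis by (simp add: power2_eq_square)
qed

text \<open>Two vectors outside \<open>Q\<close> are related by \<open>R\<close> if they generate
  the same space together with \<open>Q\<close>. This is symmetric by the exchange property, and
  each vector outside \<open>Q\<close> is related to \<open>q ^ dim Q * (q - 1)\<close> vectors, so
  the bound follows from \<open>\<psi> x * \<psi> y \<le> ((\<psi> x)\<^sup>2 + (\<psi> y)\<^sup>2)
  / 2\<close>.\<close>

lemma sum_cosets_le:
  fixes \<psi> :: "'b \<Rightarrow> real"
  assumes Q: "subspace Q" and \<psi>: "\<And>x. x \<in> Q \<Longrightarrow> \<psi> x = 0"
  shows "(\<Sum>x\<in>UNIV. \<psi> x * sum \<psi> (span (insert x Q))) \<le> q ^ dim Q * (q - 1) * (\<Sum>x\<in>UNIV. (\<psi> x)\<^sup>2)"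
proof -
  define R where "R x y \<longleftrightarrow> x \<notin> Q \<and> y \<notin> Q \<and> y \<in> span (insert x Q)" for x y
  have sym: "R x y \<longleftrightarrow> R y x" for x y
    using in_span_insert[of y x Q] in_span_insert[of x y Q] Q by (auto simp: R_def span_eq_iff[THEN iffD2])
  have deg: "(\<Sum>y\<in>UNIV. of_bool (R x y)) * (\<psi> x)\<^sup>2 = q ^ dim Q * (q - 1) * (\<psi> x)\<^sup>2" for x
  proof (cases "x \<in> Q")
    case False
    have "(\<Sum>y\<in>UNIV. of_bool (R x y)) = real (card (span (insert x Q) - Q))"
      using False by (subst real_card_eq_sum[of UNIV]) (auto simp: R_def intro!: arg_cong[where f=card])
    also have "\<dots> = real (card (span (insert x Q))) - real (card Q)"
    proof -
      have "Q \<subseteq> span (insert x Q)" using span_superset by blast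
      then show ?thesis by (simp add: card_Diff_subset of_nat_diff card_mono)
    qed
    also have "\<dots> = q ^ dim Q * (q - 1)"
      using False Q by (simp add: card_subspace dim_insert_subspace algebra_simps)
    finally show ?thesis by simp
  qed (simp add: \<psi>)
  have "(\<Sum>x\<in>UNIV. \<psi> x * sum \<psi> (span (insert x Q))) = (\<Sum>x\<in>UNIV. \<Sum>y\<in>UNIV. of_bool (R x y) * (\<psi> x * \<psi> y))"
    unfolding sum_distrib_left
    by (intro sum.cong refl sum.mono_neutral_cong_left) (auto simp: R_def \<psi>)
  also have "\<dots> \<le> (\<Sum>x\<in>UNIV. \<Sum>y\<in>UNIV. of_bool (R x y) * (((\<psi> x)\<^sup>2 + (\<psi> y)\<^sup>2) / 2))"
    using sum_squares_bound by (intro sum_mono mult_left_mono) (auto simp: field_simps)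
  also have "\<dots> = (\<Sum>x\<in>UNIV. \<Sum>y\<in>UNIV. of_bool (R x y) * (\<psi> x)\<^sup>2) / 2
      + (\<Sum>x\<in>UNIV. \<Sum>y\<in>UNIV. of_bool (R x y) * (\<psi> y)\<^sup>2) / 2"
    by (simp only: sum.distrib sum_divide_distrib distrib_left add_divide_distrib times_divide_eq_right)
  also have "(\<Sum>x\<in>UNIV. \<Sum>y\<in>UNIV. of_bool (R x y) * (\<psi> y)\<^sup>2) = (\<Sum>x\<in>UNIV. \<Sum>y\<in>UNIV. of_bool (R x y) * (\<psi> x)\<^sup>2)"
    by (subst sum.swap, intro sum.cong refl arg_cong2[where f="(*)"] arg_cong[where f=of_bool]) (rule sym)
  finally have "(\<Sum>x\<in>UNIV. \<psi> x * sum \<psi> (span (insert x Q))) \<le> (\<Sum>x\<in>UNIV. (\<Sum>y\<in>UNIV. of_bool (R x y)) * (\<psi> x)\<^sup>2)"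
    by (simp only: sum_distrib_right)
  then show ?thesis by (simp only: deg sum_distrib_left)
qed

section \<open>Functions on points and intersections with a fixed subspace\<close>

text \<open>These are the functions on vectors that come from weightings of the points; the value 0
  at the zero vector keeps it out of all sums.\<close>

definition scale_invariant :: "('b \<Rightarrow> real) \<Rightarrow> bool" where
  "scale_invariant \<psi> \<longleftrightarrow> \<psi> 0 = 0 \<and> (\<forall>c x. c \<noteq> 0 \<longrightarrow> \<psi> (c *s x) = \<psi> x)"

lemma sum_span_singleton:
  assumes "scale_invariant \<psi>"
  shows "sum \<psi> (span {x}) = (q - 1) * \<psi> x"
proof (cases "x = 0")
  case False
  have "inj_on (\<lambda>c. c *s x) UNIV" using False by (auto intro!: inj_onI simp: scale_right_imp_eq)
  then have "sum \<psi> (span {x}) = (\<Sum>c\<in>UNIV. \<psi> (c *s x))"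
    by (simp add: span_singleton sum.reindex)
  also have "\<dots> = \<psi> (0 *s x) + (\<Sum>c\<in>UNIV - {0}. \<psi> (c *s x))"
    by (rule sum.remove) auto
  also have "\<dots> = (q - 1) * \<psi> x"
    using assms by (simp add: scale_invariant_def q_def card_Diff_singleton of_nat_diff Suc_leI)
  finally show ?thesis .
qed (use assms in \<open>simp add: scale_invariant_def\<close>)

lemma complement_inter_span:
  assumes A: "subspace A" and C: "subspace C" "C \<inter> A = {0}" and x: "x \<in> C"
  shows "span (insert x A) \<inter> C = span {x}"
proof (intro equalityI subsetI)
  fix w assume w: "w \<in> span (insert x A) \<inter> C"
  then obtain c where c: "w - c *s x \<in> A" by (auto simp: span_insert_subspace A)
  moreover have "w - c *s x \<in> C" using w x C by (intro subspace_diff subspace_scale) auto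
  ultimately have "w - c *s x \<in> {0}" using C(2) by blast
  then show "w \<in> span {x}" by (auto simp: span_singleton)
next
  fix w assume "w \<in> span {x}"
  moreover have "span {x} \<subseteq> C" using x C by (intro span_minimal) auto
  ultimately show "w \<in> span (insert x A) \<inter> C" using span_mono[of "{x}" "insert x A"] by auto
qed

lemma card_minus_zero: "subspace S \<Longrightarrow> real (card (S - {0})) = q ^ dim S - 1"
proof -
  assume S: "subspace S"
  then have "card (S - {0}) = card S - 1" "card S > 0"
    using subspace_0[of S] by (auto simp: card_gt_0_iff)
  then show ?thesis using card_subspace[OF S] by (simp add: of_nat_diff Suc_leI)
qed

text \<open>The size \<open>y\<close> of \<open>S \<inter> C\<close> is 1, \<open>q\<close> or at
  least \<open>q\<^sup>2\<close>. The product \<open>(y - q) * (y - 1)\<close> vanishes in the first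
  two cases and is at least \<open>(q\<^sup>2 - 1) * (y - q)\<close> in the third. Hence
  \<open>y - 1\<close> exceeds \<open>q - 1\<close> by at most that product divided by
  \<open>q\<^sup>2 - 1\<close>, and the total of the product over all \<open>k\<close>-spaces
  disjoint from \<open>A\<close> can be computed exactly.\<close>

lemma meeting_common_card:
  assumes A: "subspace A" and C: "C \<in> meeting k {0} A" and F: "\<F> \<subseteq> meeting k {0} A"
    and t: "dim A = t"
  shows "(\<Sum>S\<in>\<F>. real (card (S \<inter> C)) - 1) \<le>
    (q - 1) * real (card \<F>) + (q ^ k - 1) * (q ^ k - q) * meet_count k 2 t / (q\<^sup>2 - 1)"
proof -
  let ?K = "meeting k {0} A"
  define y where "y S = real (card (S \<inter> C))" for S
  have Cs: "subspace C" "dim C = k" "C \<inter> A = {0}" using C by (auto simp: meeting_def)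
  have q2: "q\<^sup>2 - 1 > 0" using q_ge_2 by (simp add: power2_eq_square) (smt (verit) mult_le_cancel_left1)
  have yS: "(\<Sum>x\<in>S. of_bool (x \<in> C)) = y S" for S
    using real_card_eq_sum[of S "S \<inter> C"] by (simp add: y_def)
  \<comment> \<open>The multiples of \<open>x\<close> are common to \<open>S\<close> and
    \<open>C\<close> for every such \<open>S\<close>; subtracting \<open>q\<close> cancels their
    contribution, and only the \<open>q ^ k - q\<close> other vectors of \<open>C\<close>
    remain.\<close>
  have thr: "(\<Sum>S | S \<in> ?K \<and> x \<in> S. y S - q) = meet_count k 2 t * (q ^ k - q)" if x: "x \<in> C - {0}" for x
  proof -
    have xA: "x \<notin> A" using x Cs by auto
    have spx: "span {x} \<subseteq> C" using x Cs by (intro span_minimal) auto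
    have cx: "real (card (span {x})) = q"
      using x card_subspace[of "span {x}"] dim_insert_subspace[OF subspace_single_0, of x]
      by (simp add: insert_commute dim_insert)
    have 1: "sum (\<lambda>x. of_bool (x \<in> C)) (span {x}) = q"
    proof -
      have "span {x} \<inter> C = span {x}" using spx by auto
      then show ?thesis using yS[of "span {x}"] cx by (simp add: y_def)
    qed
    have "span (insert x A) \<inter> C = span {x}" using x by (intro complement_inter_span A Cs) auto
    then have 2: "sum (\<lambda>x. of_bool (x \<in> C)) (span (insert x A)) = q"
      using yS[of "span (insert x A)"] cx by (simp add: y_def)
    have 3: "sum (\<lambda>x. of_bool (x \<in> C)) UNIV = q ^ k"
      using yS[of UNIV] Cs card_subspace[of C] by (simp add: y_def)
    have "(\<Sum>S | S \<in> ?K \<and> x \<in> S. sum (\<lambda>x. of_bool (x \<in> C)) S) =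
        meet_count k 1 t * q + meet_count k 2 t * (q ^ k - q)"
      using sum_meeting_through[of "{0}" A 0 t x "\<lambda>x. of_bool (x \<in> C)" k] A t xA 1 2 3
      by (simp add: subspace_0 numeral_2_eq_2 insert_commute[of x 0])
    moreover have "real (card {S \<in> ?K. x \<in> S}) = meet_count k 1 t"
      using card_meeting_through[of "{0}" A 0 t x k] A t xA by (simp add: subspace_0)
    ultimately show ?thesis by (simp only: yS sum_subtractf) (simp add: algebra_simps)
  qed
  have "(\<Sum>S\<in>?K. (y S - q) * (y S - 1)) = (\<Sum>S\<in>?K. (y S - q) * (\<Sum>x\<in>S. of_bool (x \<in> C - {0})))"
  proof (intro sum.cong refl)
    fix S assume "S \<in> ?K"
    then have "subspace (S \<inter> C)" using Cs by (intro subspace_inter) (auto simp: subspace_meeting)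
    then have "y S - 1 = real (card (S \<inter> C - {0}))" by (simp add: y_def card_minus_zero card_subspace)
    also have "\<dots> = (\<Sum>x\<in>S. of_bool (x \<in> S \<inter> C - {0}))" by (rule real_card_eq_sum) auto
    also have "\<dots> = (\<Sum>x\<in>S. of_bool (x \<in> C - {0}))" by (intro sum.cong refl) auto
    finally show "(y S - q) * (y S - 1) = (y S - q) * (\<Sum>x\<in>S. of_bool (x \<in> C - {0}))" by simp
  qed
  also have "\<dots> = (\<Sum>x\<in>UNIV. of_bool (x \<in> C - {0}) * (\<Sum>S | S \<in> ?K \<and> x \<in> S. y S - q))"
    by (rule sum_incidence_weighted)
  also have "\<dots> = (\<Sum>x\<in>C - {0}. meet_count k 2 t * (q ^ k - q))"
    by (rule sum.mono_neutral_cong_right) (auto simp: thr)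
  also have "\<dots> = (q ^ k - 1) * (q ^ k - q) * meet_count k 2 t"
    using card_minus_zero[OF Cs(1)] Cs(2) by simp
  finally have tot: "(\<Sum>S\<in>?K. (y S - q) * (y S - 1)) = (q ^ k - 1) * (q ^ k - q) * meet_count k 2 t" .
  have pw: "(y S - q) * (y S - 1) \<ge> 0 \<and> y S - 1 \<le> (q - 1) + (y S - q) * (y S - 1) / (q\<^sup>2 - 1)"
    if "S \<in> ?K" for S
  proof -
    have "subspace (S \<inter> C)" using that Cs by (intro subspace_inter) (auto simp: subspace_meeting)
    then have "y S = q ^ dim (S \<inter> C)" by (simp add: y_def card_subspace)
    then consider "y S = 1" | "y S = q" | "y S \<ge> q\<^sup>2"
    proof -
      have "dim (S \<inter> C) = 0 \<or> dim (S \<inter> C) = 1 \<or> dim (S \<inter> C) \<ge> 2" by linarith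
      then show ?thesis using that \<open>y S = q ^ dim (S \<inter> C)\<close> q_ge_2
        by (metis (full_types) power_0 power_one_right power_increasing one_le_numeral order_trans)
    qed
    then show ?thesis
    proof cases
      case 3
      then have "y S - 1 > 0" "y S - 1 \<ge> q\<^sup>2 - 1" using q2 by auto
      moreover have "y S - q \<ge> 0" using 3 q_ge_2 self_le_power[of q 2] by simp
      moreover have "(y S - q) * (q\<^sup>2 - 1) \<le> (y S - q) * (y S - 1)"
        using calculation by (intro mult_left_mono) auto
      then have "y S - q \<le> (y S - q) * (y S - 1) / (q\<^sup>2 - 1)" using q2 by (simp add: pos_le_divide_eq)
      ultimately show ?thesis by (auto intro!: mult_nonneg_nonneg)
    qed (use q_ge_2 in auto)
  qed
  have "(\<Sum>S\<in>\<F>. y S - 1) \<le> (\<Sum>S\<in>\<F>. (q - 1) + (y S - q) * (y S - 1) / (q\<^sup>2 - 1))"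
    using pw F by (intro sum_mono) auto
  also have "\<dots> = (q - 1) * real (card \<F>) + (\<Sum>S\<in>\<F>. (y S - q) * (y S - 1)) / (q\<^sup>2 - 1)"
    by (simp add: sum.distrib sum_divide_distrib)
  also have "(\<Sum>S\<in>\<F>. (y S - q) * (y S - 1)) \<le> (\<Sum>S\<in>?K. (y S - q) * (y S - 1))"
    using pw F by (intro sum_mono2) auto
  finally have "(\<Sum>S\<in>\<F>. y S - 1) \<le>
      (q - 1) * real (card \<F>) + (q ^ k - 1) * (q ^ k - q) * meet_count k 2 t / (q\<^sup>2 - 1)"
    using q2 by (simp add: tot divide_right_mono)
  then show ?thesis by (simp add: y_def)
qed

lemma meet_count_zero: "k < j \<Longrightarrow> meet_count k j t = 0"
  by (simp add: meet_count_def)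

lemma meet_count_pos:
  assumes "k + t \<le> dimension" "j \<le> k"
  shows "meet_count k j t > 0"
proof -
  have "0 < (q ^ dimension - q ^ (i + t)) / (q ^ k - q ^ i)" if "i \<in> {j..<k}" for i
    using that assms q_ge_2 by (auto intro!: divide_pos_pos power_strict_increasing simp del: power_add)
  then show ?thesis using assms by (auto simp: meet_count_def intro!: prod_pos)
qed

lemma meet_count_nonneg: "k + t \<le> dimension \<Longrightarrow> meet_count k j t \<ge> 0"
  using meet_count_pos[of k t j] meet_count_zero[of k j t] by (cases "j \<le> k") auto

lemma sum_subspace_squared_le:
  fixes \<psi> :: "'b \<Rightarrow> real"
  assumes "subspace S" "\<psi> 0 = 0"
  shows "(sum \<psi> S)\<^sup>2 \<le> (q ^ dim S - 1) * (\<Sum>x\<in>UNIV. (\<psi> x)\<^sup>2)"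
proof -
  have "sum \<psi> S = sum \<psi> (S - {0})"
    using assms by (intro sum.mono_neutral_right) auto
  then have "(sum \<psi> S)\<^sup>2 = (\<Sum>x\<in>S - {0}. 1 * \<psi> x)\<^sup>2" by simp
  also have "\<dots> \<le> (\<Sum>x\<in>S - {0}. 1\<^sup>2) * (\<Sum>x\<in>S - {0}. (\<psi> x)\<^sup>2)"
    by (rule Cauchy_Schwarz_ineq_sum)
  also have "\<dots> = (q ^ dim S - 1) * (\<Sum>x\<in>S - {0}. (\<psi> x)\<^sup>2)"
    using card_minus_zero[OF assms(1)] by simp
  also have "\<dots> \<le> (q ^ dim S - 1) * (\<Sum>x\<in>UNIV. (\<psi> x)\<^sup>2)"
    using q_ge_2 by (intro mult_left_mono sum_mono2) auto
  finally show ?thesis .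
qed

text \<open>After exchanging the sums, \<open>\<psi> y\<close> is multiplied by the number
  \<open>t y\<close> of nonzero \<open>x\<close> in \<open>C\<close> whose span with
  \<open>A\<close> contains \<open>y\<close>. For \<open>y\<close> outside \<open>A\<close> these
  \<open>x\<close> lie on a single point, so \<open>t y \<le> q - 1\<close>. The Cauchy-Schwarz
  inequality then leaves the sum of the squares of \<open>t\<close>, which is at most
  \<open>q - 1\<close> times the sum of \<open>t\<close>.\<close>

lemma sum_cosets_along_le:
  fixes \<psi> :: "'b \<Rightarrow> real"
  assumes A: "subspace A" and C: "subspace C" "C \<inter> A = {0}" and \<psi>: "\<And>x. x \<in> A \<Longrightarrow> \<psi> x = 0"
  shows "(\<Sum>x\<in>C - {0}. sum \<psi> (span (insert x A)))\<^sup>2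
    \<le> (q - 1)\<^sup>2 * q ^ dim A * (q ^ dim C - 1) * (\<Sum>x\<in>UNIV. (\<psi> x)\<^sup>2)"
proof -
  define t where "t y = (\<Sum>x\<in>C - {0}. of_bool (y \<in> span (insert x A)) :: real)" for y
  have t_le: "t y \<le> q - 1" if "y \<notin> A" for y
  proof (cases "\<exists>x\<in>C - {0}. y \<in> span (insert x A)")
    case True
    then obtain x0 where x0: "x0 \<in> C - {0}" "y \<in> span (insert x0 A)" by auto
    have "{x \<in> C - {0}. y \<in> span (insert x A)} \<subseteq> span {x0} - {0}"
    proof
      fix x assume x: "x \<in> {x \<in> C - {0}. y \<in> span (insert x A)}"
      \<comment> \<open>By exchange, \<open>x\<close> lies in the span of \<open>y\<close> and
        \<open>A\<close>, hence in that of \<open>x0\<close> and \<open>A\<close>, which meets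
        \<open>C\<close> in the multiples of \<open>x0\<close> only.\<close>
      have "y \<notin> span A" using that A by (simp add: span_eq_iff[THEN iffD2])
      then have "x \<in> span (insert y A)" using x in_span_insert by auto
      moreover have "span (insert y A) \<subseteq> span (insert x0 A)"
        using x0 by (intro span_minimal) (auto simp: span_base)
      ultimately show "x \<in> span {x0} - {0}" using complement_inter_span[OF A C, of x0] x x0 by auto
    qed
    then have "card {x \<in> C - {0}. y \<in> span (insert x A)} \<le> card (span {x0} - {0})" by (intro card_mono) auto
    moreover have "real (card (span {x0} - {0})) = q - 1"
      using x0 card_minus_zero[of "span {x0}"] by (simp add: dim_insert)
    moreover have "t y = real (card {x \<in> C - {0}. y \<in> span (insert x A)})"
      unfolding t_def by (subst real_card_eq_sum[of "C - {0}"]) (auto intro!: sum.cong)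
    ultimately show ?thesis by linarith
  next
    case False
    then have "t y = 0" by (auto simp: t_def intro!: sum.neutral)
    then show ?thesis using q_ge_2 by simp
  qed
  have t0: "t y \<ge> 0" for y by (auto simp: t_def intro!: sum_nonneg)
  have "(\<Sum>x\<in>C - {0}. sum \<psi> (span (insert x A))) = (\<Sum>x\<in>C - {0}. \<Sum>y\<in>UNIV. \<psi> y * of_bool (y \<in> span (insert x A)))"
    by (intro sum.cong refl sum.mono_neutral_cong_left) auto
  also have "\<dots> = (\<Sum>y\<in>UNIV. \<psi> y * t y)"
    by (subst sum.swap) (simp only: t_def sum_distrib_left)
  also have "\<dots> = (\<Sum>y\<in>UNIV. \<psi> y * (of_bool (y \<notin> A) * t y))"
    using \<psi> by (intro sum.cong refl) auto
  also have "\<dots>\<^sup>2 \<le> (\<Sum>y\<in>UNIV. (\<psi> y)\<^sup>2) * (\<Sum>y\<in>UNIV. (of_bool (y \<notin> A) * t y)\<^sup>2)"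
    by (rule Cauchy_Schwarz_ineq_sum)
  finally have 1: "(\<Sum>x\<in>C - {0}. sum \<psi> (span (insert x A)))\<^sup>2 \<le> (\<Sum>y\<in>UNIV. (\<psi> y)\<^sup>2) * (\<Sum>y\<in>UNIV. (of_bool (y \<notin> A) * t y)\<^sup>2)" .
  have "(\<Sum>y\<in>UNIV. (of_bool (y \<notin> A) * t y)\<^sup>2) \<le> (\<Sum>y\<in>UNIV. (q - 1) * (of_bool (y \<notin> A) * t y))"
  proof (intro sum_mono)
    fix y show "(of_bool (y \<notin> A) * t y)\<^sup>2 \<le> (q - 1) * (of_bool (y \<notin> A) * t y)"
      using t_le[of y] t0[of y] by (cases "y \<in> A") (auto simp: power2_eq_square intro!: mult_right_mono)
  qed
  also have "\<dots> = (q - 1) * (\<Sum>y\<in>UNIV. \<Sum>x\<in>C - {0}. of_bool (y \<in> span (insert x A) - A))"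
    unfolding t_def sum_distrib_left by (intro sum.cong refl) auto
  also have "(\<Sum>y\<in>UNIV. \<Sum>x\<in>C - {0}. of_bool (y \<in> span (insert x A) - A) :: real)
      = (\<Sum>x\<in>C - {0}. \<Sum>y\<in>UNIV. of_bool (y \<in> span (insert x A) - A))"
    by (rule sum.swap)
  also have "\<dots> = (\<Sum>x\<in>C - {0}. q ^ dim A * (q - 1))"
  proof (intro sum.cong refl)
    fix x assume x: "x \<in> C - {0}"
    then have xA: "x \<notin> A" using C by auto
    have "A \<subseteq> span (insert x A)" using span_superset by blast
    then have "real (card (span (insert x A) - A)) = real (card (span (insert x A))) - real (card A)"
      by (simp add: card_Diff_subset of_nat_diff card_mono)
    also have "\<dots> = q ^ dim A * (q - 1)"
      using A xA by (simp add: card_subspace dim_insert_subspace algebra_simps)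
    finally show "(\<Sum>y\<in>UNIV. of_bool (y \<in> span (insert x A) - A)) = q ^ dim A * (q - 1)"
      using real_card_eq_sum[of UNIV "span (insert x A) - A"] by simp
  qed
  also have "\<dots> = (q ^ dim C - 1) * (q ^ dim A * (q - 1))"
    using card_minus_zero[OF C(1)] by simp
  finally have 2: "(\<Sum>y\<in>UNIV. (of_bool (y \<notin> A) * t y)\<^sup>2) \<le> (q - 1) * ((q ^ dim C - 1) * (q ^ dim A * (q - 1)))" .
  have "(\<Sum>y\<in>UNIV. (\<psi> y)\<^sup>2) \<ge> 0" by (intro sum_nonneg) auto
  from mult_left_mono[OF 2 this] 1 show ?thesis by (simp add: power2_eq_square mult_ac)
qed

text \<open>The factor \<open>card (S \<inter> C) - 1\<close> counts the nonzero common vectors, so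
  the sum splits into first moments over the \<open>S\<close> through each nonzero \<open>x\<close>
  in \<open>C\<close>. The contribution of \<open>sum \<psi> UNIV\<close> is zero.\<close>

lemma sum_weighted_common:
  fixes \<psi> :: "'b \<Rightarrow> real"
  assumes A: "subspace A" "dim A = t" and C: "subspace C" "C \<inter> A = {0}"
    and \<psi>: "scale_invariant \<psi>" "sum \<psi> UNIV = 0"
  shows "(\<Sum>S\<in>meeting k {0} A. sum \<psi> S * (real (card (S \<inter> C)) - 1)) =
    meet_count k 1 t * (q - 1) * sum \<psi> C - meet_count k 2 t * (\<Sum>x\<in>C - {0}. sum \<psi> (span (insert x A)))"
proof -
  let ?K = "meeting k {0} A"
  have "(\<Sum>S\<in>?K. sum \<psi> S * (real (card (S \<inter> C)) - 1)) = (\<Sum>S\<in>?K. sum \<psi> S * (\<Sum>x\<in>S. of_bool (x \<in> C - {0})))"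
  proof (intro sum.cong refl)
    fix S assume "S \<in> ?K"
    then have "subspace (S \<inter> C)" using C by (intro subspace_inter) (auto simp: subspace_meeting)
    then have "real (card (S \<inter> C)) - 1 = real (card (S \<inter> C - {0}))" by (simp add: card_minus_zero card_subspace)
    also have "\<dots> = (\<Sum>x\<in>S. of_bool (x \<in> S \<inter> C - {0}))" by (rule real_card_eq_sum) auto
    also have "\<dots> = (\<Sum>x\<in>S. of_bool (x \<in> C - {0}))" by (intro sum.cong refl) auto
    finally show "sum \<psi> S * (real (card (S \<inter> C)) - 1) = sum \<psi> S * (\<Sum>x\<in>S. of_bool (x \<in> C - {0}))" by simp
  qed
  also have "\<dots> = (\<Sum>x\<in>UNIV. of_bool (x \<in> C - {0}) * (\<Sum>S | S \<in> ?K \<and> x \<in> S. sum \<psi> S))"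
    by (rule sum_incidence_weighted)
  also have "\<dots> = (\<Sum>x\<in>C - {0}. meet_count k 1 t * (q - 1) * \<psi> x - meet_count k 2 t * sum \<psi> (span (insert x A)))"
  proof (rule sum.mono_neutral_cong_right)
    show "\<forall>i\<in>UNIV - (C - {0}). of_bool (i \<in> C - {0}) * (\<Sum>S | S \<in> ?K \<and> i \<in> S. sum \<psi> S) = 0" by auto
    fix x assume x: "x \<in> C - {0}"
    then have "x \<notin> A" using C by auto
    then have "(\<Sum>S | S \<in> ?K \<and> x \<in> S. sum \<psi> S) =
        meet_count k 1 t * sum \<psi> (span {x}) - meet_count k 2 t * sum \<psi> (span (insert x A))"
      using sum_meeting_through[of "{0}" A 0 t x \<psi> k] A \<psi>
      by (simp add: subspace_0 numeral_2_eq_2 insert_commute[of x 0])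
    then show "of_bool (x \<in> C - {0}) * (\<Sum>S | S \<in> ?K \<and> x \<in> S. sum \<psi> S) =
        meet_count k 1 t * (q - 1) * \<psi> x - meet_count k 2 t * sum \<psi> (span (insert x A))"
      using x sum_span_singleton[OF \<psi>(1), of x] by simp
  qed auto
  also have "\<dots> = meet_count k 1 t * (q - 1) * sum \<psi> (C - {0}) - meet_count k 2 t * (\<Sum>x\<in>C - {0}. sum \<psi> (span (insert x A)))"
    by (simp add: sum_subtractf sum_distrib_left)
  also have "sum \<psi> (C - {0}) = sum \<psi> C"
    using \<psi> by (intro sum.mono_neutral_left) (auto simp: scale_invariant_def)
  finally show ?thesis .
qed

text \<open>The square of \<open>W S\<close> is at most \<open>M * W S\<close> for nonnegative
  members and at most \<open>m * (- W S)\<close> for negative ones. The positive and the negative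
  parts have the same total size, which is at most \<open>M\<close> times the number of nonnegative
  members.\<close>

lemma second_moment_le:
  fixes W :: "'b set \<Rightarrow> real"
  assumes "(\<Sum>S\<in>K. W S) = 0" "\<And>S. S \<in> K \<Longrightarrow> W S \<le> M" "\<And>S. S \<in> K \<Longrightarrow> - W S \<le> m" "M \<ge> 0" "m \<ge> 0"
  shows "(\<Sum>S\<in>K. (W S)\<^sup>2) \<le> (M + m) * M * real (card {S \<in> K. W S \<ge> 0})"
proof -
  let ?F = "{S \<in> K. W S \<ge> 0}"
  have s: "(\<Sum>S\<in>K. h S) = (\<Sum>S\<in>?F. h S) + (\<Sum>S\<in>K - ?F. h S)" for h :: "'b set \<Rightarrow> real"
    by (subst sum.subset_diff[of ?F]) auto
  have "(\<Sum>S\<in>K. (W S)\<^sup>2) \<le> (\<Sum>S\<in>?F. M * W S) + (\<Sum>S\<in>K - ?F. m * (- W S))"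
    unfolding s[of "\<lambda>S. (W S)\<^sup>2"]
  proof (intro add_mono sum_mono)
    fix S assume "S \<in> ?F" then show "(W S)\<^sup>2 \<le> M * W S"
      using assms(2)[of S] by (auto simp: power2_eq_square intro: mult_right_mono)
  next
    fix S assume "S \<in> K - ?F" then show "(W S)\<^sup>2 \<le> m * (- W S)"
      using assms(3)[of S] mult_right_mono[of "- W S" m "- W S"] by (auto simp: power2_eq_square)
  qed
  also have "\<dots> = M * (\<Sum>S\<in>?F. W S) + m * (- (\<Sum>S\<in>K - ?F. W S))"
    by (simp add: sum_distrib_left sum_negf)
  also have "- (\<Sum>S\<in>K - ?F. W S) = (\<Sum>S\<in>?F. W S)" using s[of W] assms(1) by simp
  also have "M * (\<Sum>S\<in>?F. W S) + m * (\<Sum>S\<in>?F. W S) = (M + m) * (\<Sum>S\<in>?F. W S)" by (simp add: algebra_simps)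
  also have "\<dots> \<le> (M + m) * (M * real (card ?F))"
    using sum_bounded_above[of ?F W M] assms by (intro mult_left_mono) (auto simp: mult.commute)
  finally show ?thesis by (simp add: mult.assoc)
qed

lemma finite_maximizer:
  fixes W :: "'b set \<Rightarrow> real"
  assumes "K \<noteq> {}"
  obtains C where "C \<in> K" "\<And>S. S \<in> K \<Longrightarrow> W S \<le> W C"
proof -
  have "Max (W ` K) \<in> W ` K" using assms by (intro Max_in) auto
  then obtain C where "C \<in> K" "W C = Max (W ` K)" by auto
  then show thesis using that[of C] by auto
qed

section \<open>Nonnegative subspaces avoiding a negative subspace\<close>

lemma q_power_ge:
  assumes "k \<ge> 2"
  shows "q ^ k \<ge> q\<^sup>2" "q ^ k \<ge> 4" "q ^ k > q"
proof -
  show 1: "q ^ k \<ge> q\<^sup>2" using assms q_ge_2 by (intro power_increasing) auto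
  have 2: "q * q \<ge> 2 * q" using q_ge_2 by (intro mult_right_mono) auto
  then have "q\<^sup>2 \<ge> 4" "q\<^sup>2 > q" unfolding power2_eq_square using q_ge_2 by linarith+
  then show "q ^ k \<ge> 4" "q ^ k > q" using 1 by linarith+
qed

text \<open>With \<open>dim A = t\<close>, the quotient is the proportion, among the
  \<open>k\<close>-spaces disjoint from \<open>A\<close> through some \<open>x\<close> outside
  \<open>A\<close>, of those that also contain a given vector outside the span of \<open>x\<close>
  and \<open>A\<close>. It is small, and all error terms are governed by it.\<close>

lemma meet_count_ratio:
  assumes "k \<ge> 2" "3 * k \<le> dimension" "t \<le> k"
  shows "meet_count k 2 t = (q ^ k - q) / (q ^ dimension - q ^ t * q) * meet_count k 1 t"
    "q ^ dimension - q ^ t * q > 0"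
proof -
  have "q ^ Suc t < q ^ dimension" using assms q_ge_2 by (intro power_strict_increasing) auto
  then show "q ^ dimension - q ^ t * q > 0" by (simp add: mult.commute)
  then show "meet_count k 2 t = (q ^ k - q) / (q ^ dimension - q ^ t * q) * meet_count k 1 t"
    using meet_count_rec[of 1 k t] assms by (simp add: field_simps numeral_2_eq_2)
qed

text \<open>With fewer than \<open>\<eta> * l\<close> nonnegative members, the second moment forces
  the maximal weight \<open>M\<close> to be large (\<open>i\<close>), while the sum weighted by
  intersections with a maximizer \<open>C\<close> bounds \<open>M\<close> by
  \<open>\<rho> * H\<close> (\<open>ii\<close>), and \<open>H\<close> is small by the Cauchy-Schwarz
  inequality (\<open>iii\<close>). \<open>avoid_numeric\<close> shows that these are
  incompatible.\<close>

lemma avoiding_count_zero: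
  assumes A: "subspace A" "dim A = k" and k: "k \<ge> 2" "3 * k \<le> dimension"
    and \<psi>: "scale_invariant \<psi>" "\<And>x. x \<in> A \<Longrightarrow> \<psi> x = 0" "sum \<psi> UNIV = 0"
  shows "avoid_const (q ^ k) * meet_count k 1 k \<le> real (card {S \<in> meeting k {0} A. sum \<psi> S \<ge> 0})"
proof (rule ccontr)
  define z where "z = q ^ k"
  define K where "K = meeting k {0} A"
  define F where "F = {S \<in> K. sum \<psi> S \<ge> 0}"
  define l where "l = meet_count k 1 k"
  define c where "c = meet_count k 2 k"
  define \<rho> where "\<rho> = (z - q) / (q ^ dimension - z * q)"
  define b where "b = (\<Sum>x\<in>UNIV. (\<psi> x)\<^sup>2)"
  define \<eta> where "\<eta> = avoid_const z"
  define \<kappa> where "\<kappa> = (z - 1) * (z - q) * \<rho> / ((q - 1) * (q\<^sup>2 - 1))"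
  define Q where "Q = (z - 1) / (q - 1)"
  define T where "T = 1 - \<kappa> - \<eta>"
  assume "\<not> ?thesis"
  then have small: "real (card F) < \<eta> * l" by (simp add: F_def K_def \<eta>_def l_def z_def)
  have q1: "q - 1 > 0" "q > 0" using q_ge_2 by auto
  have q21: "q\<^sup>2 - 1 > 0" using q_ge_2 power_mono[of 2 q 2] by simp
  have z: "z \<ge> 4" "z > q" "z \<ge> q\<^sup>2" using q_power_ge[OF k(1)] by (auto simp: z_def)
  have l: "l > 0" using meet_count_pos[of k k 1] k by (simp add: l_def)
  have c: "c = \<rho> * l" "q ^ dimension - z * q > 0"
    using meet_count_ratio[OF k order_refl] by (simp_all add: c_def \<rho>_def l_def z_def)
  have \<rho>0: "\<rho> \<ge> 0" using c z by (simp add: \<rho>_def)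
  have \<rho>1: "\<rho> \<le> (z - q) / (z * (z\<^sup>2 - q))"
  proof -
    have "z ^ 3 \<le> q ^ dimension"
      unfolding z_def power_mult[symmetric] using k q_ge_2 by (intro power_increasing) auto
    then have "z * (z\<^sup>2 - q) \<le> q ^ dimension - z * q"
      by (simp add: power2_eq_square power3_eq_cube algebra_simps)
    moreover have "1 * z < z * z" using z by (intro mult_strict_right_mono) auto
    then have "z\<^sup>2 - q > 0" using z(2) by (simp add: power2_eq_square)
    then have "z * (z\<^sup>2 - q) > 0" using z(1) by simp
    ultimately show ?thesis unfolding \<rho>_def using z by (intro frac_le) auto
  qed
  have \<psi>0: "\<psi> 0 = 0" using \<psi>(1) by (simp add: scale_invariant_def)
  have b0: "b \<ge> 0" by (auto simp: b_def intro: sum_nonneg)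
  have \<eta>: "0 \<le> \<eta>" "\<eta> \<le> 1" by (auto simp: \<eta>_def avoid_const_def)
  obtain p where p: "p \<notin> A"
  proof -
    have "dim A < dim (UNIV :: 'b set)" using A k by (simp add: dimension_def del: dim_UNIV) (simp add: dimension_def)
    then show thesis using that by (metis UNIV_eq_I less_irrefl)
  qed
  have lK: "real (card {S \<in> K. p \<in> S}) = l"
    using card_meeting_through[of "{0}" A 0 k p k] A p by (simp add: K_def l_def subspace_0)
  \<comment> \<open>The \<open>l\<close> members through one vector outside \<open>A\<close> already
    make \<open>K\<close> nonempty, and large enough to rule out \<open>\<psi> = 0\<close>
    below.\<close>
  have cK: "l \<le> real (card K)" unfolding lK[symmetric] by (auto intro!: card_mono)
  then have Kne: "K \<noteq> {}" using l by auto
  have bpos: "b > 0"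
  proof (rule ccontr)
    assume "\<not> b > 0"
    then have "b = 0" using b0 by simp
    then have "\<psi> x = 0" for x using finite_carrier by (simp add: b_def sum_nonneg_eq_0_iff)
    then have "F = K" by (auto simp: F_def)
    moreover have "\<eta> * l \<le> 1 * l" using \<eta> l by (intro mult_right_mono) auto
    ultimately show False using small cK by simp
  qed
  obtain C where C: "C \<in> K" "\<And>S. S \<in> K \<Longrightarrow> sum \<psi> S \<le> sum \<psi> C"
    using finite_maximizer[OF Kne, of "sum \<psi>"] by blast
  have Cs: "subspace C" "dim C = k" "C \<inter> A = {0}" using C by (auto simp: K_def meeting_def)
  define M where "M = sum \<psi> C"
  \<comment> \<open>Not the exact extreme of the negative weights, but the Cauchy-Schwarz bound for
    the absolute weight of any \<open>k\<close>-space.\<close>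
  define m where "m = sqrt ((z - 1) * b)"
  have m: "m \<ge> 0" "m\<^sup>2 = (z - 1) * b" using z b0 by (auto simp: m_def)
  have WK: "(\<Sum>S\<in>K. sum \<psi> S) = 0"
    using sum_meeting[of "{0}" A 0 k \<psi> k] A \<psi> \<psi>0 by (simp add: K_def subspace_0)
  have M: "M \<ge> 0"
  proof -
    have "0 \<le> real (card K) * M"
      using sum_bounded_above[of K "sum \<psi>" M] C WK by (simp add: M_def)
    then show ?thesis using cK l Kne by (simp add: zero_le_mult_iff)
  qed
  have Wm: "- sum \<psi> S \<le> m" if "S \<in> K" for S
  proof -
    have "(- sum \<psi> S)\<^sup>2 \<le> (z - 1) * b"
      using sum_subspace_squared_le[of S \<psi>] that \<psi>0 by (simp add: K_def meeting_def z_def b_def)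
    then show ?thesis unfolding m_def by (rule real_le_rsqrt)
  qed
  \<comment> \<open>The second moment is bounded below by its exact formula with
    \<open>sum_cosets_le\<close>, and above through the number of nonnegative members.\<close>
  have i: "(q - 1) * b * (1 - \<rho> * z) \<le> \<eta> * (M\<^sup>2 + M * m)"
  proof -
    have "(\<Sum>x\<in>UNIV. \<psi> x * sum \<psi> (span (insert x {0}))) = (q - 1) * b"
      using sum_span_singleton[OF \<psi>(1)]
      by (simp add: insert_commute[of _ 0] b_def sum_distrib_left power2_eq_square mult_ac)
    then have "(\<Sum>S\<in>K. (sum \<psi> S)\<^sup>2) = l * ((q - 1) * b) - c * (\<Sum>x\<in>UNIV. \<psi> x * sum \<psi> (span (insert x A)))"
      using second_moment_meeting[of "{0}" A 0 k \<psi> k] A \<psi>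
      by (simp add: K_def l_def c_def subspace_0 numeral_2_eq_2)
    moreover have "c * (\<Sum>x\<in>UNIV. \<psi> x * sum \<psi> (span (insert x A))) \<le> c * (z * (q - 1) * b)"
      using sum_cosets_le[OF A(1) \<psi>(2)] A c(1) \<rho>0 l by (intro mult_left_mono) (auto simp: z_def b_def)
    ultimately have "l * ((q - 1) * b * (1 - \<rho> * z)) \<le> (\<Sum>S\<in>K. (sum \<psi> S)\<^sup>2)"
      by (simp add: c(1) algebra_simps)
    also have "\<dots> \<le> (M + m) * M * real (card F)"
      unfolding F_def using C Wm M m by (intro second_moment_le WK) (auto simp: M_def)
    also have "\<dots> \<le> (M + m) * M * (\<eta> * l)" using small M m by (intro mult_left_mono) auto
    also have "\<dots> = l * (\<eta> * (M\<^sup>2 + M * m))" by (simp add: algebra_simps power2_eq_square)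
    finally show ?thesis using l by simp
  qed
  define H where "H = (\<Sum>x\<in>C - {0}. sum \<psi> (span (insert x A)))"
  have ii: "(q - 1) * M * T \<le> \<rho> * H"
  proof -
    have com: "real (card (S \<inter> C)) - 1 \<ge> 0" if "S \<in> K" for S
    proof -
      have "subspace (S \<inter> C)" using that Cs by (intro subspace_inter) (auto simp: K_def subspace_meeting)
      then show ?thesis using q_ge_2 by (simp add: card_subspace one_le_power)
    qed
    have "l * (q - 1) * M - c * H = (\<Sum>S\<in>K. sum \<psi> S * (real (card (S \<inter> C)) - 1))"
      using sum_weighted_common[of A k C \<psi> k] A Cs \<psi> by (simp add: K_def l_def c_def M_def H_def)
    \<comment> \<open>The multipliers are nonnegative, so negative members may be dropped and the
      others replaced by the maximal weight.\<close>
    also have "\<dots> \<le> (\<Sum>S\<in>K. if S \<in> F then M * (real (card (S \<inter> C)) - 1) else 0)"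
      using com C by (intro sum_mono) (auto simp: F_def M_def intro!: mult_right_mono mult_nonpos_nonneg)
    also have "\<dots> = M * (\<Sum>S\<in>F. real (card (S \<inter> C)) - 1)"
      by (simp add: sum.If_cases sum_distrib_left) (auto intro!: sum.cong simp: F_def)
    also have "\<dots> \<le> M * ((q - 1) * real (card F) + (z - 1) * (z - q) * c / (q\<^sup>2 - 1))"
      using meeting_common_card[of A C k F k] A C M by (intro mult_left_mono) (auto simp: K_def F_def z_def c_def)
    also have "(z - 1) * (z - q) * c / (q\<^sup>2 - 1) = (q - 1) * \<kappa> * l"
      using q1 by (simp add: \<kappa>_def c(1))
    also have "M * ((q - 1) * real (card F) + (q - 1) * \<kappa> * l) \<le> M * ((q - 1) * (\<eta> * l) + (q - 1) * \<kappa> * l)"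
      using small M q1 by (intro mult_left_mono add_right_mono) auto
    finally have "l * ((q - 1) * M * T) \<le> l * (\<rho> * H)" by (simp add: T_def c(1) algebra_simps)
    then show ?thesis using l by simp
  qed
  have iii: "H\<^sup>2 \<le> (q - 1)\<^sup>2 * (z * (z - 1) * b)"
    using sum_cosets_along_le[of A C \<psi>] A Cs \<psi> by (simp add: H_def z_def b_def mult.assoc)
  have qC: "q = real CARD('a)" "CARD('a) \<ge> 2" using q_def q_ge_2 by auto
  obtain v where T: "T > 0" and v: "v \<ge> 0" "\<rho>\<^sup>2 * z * Q\<^sup>2 \<le> T\<^sup>2 * v\<^sup>2"
    "\<eta> * (\<rho>\<^sup>2 * z * Q / T\<^sup>2 + v) < 1 - \<rho> * z"
    using avoid_numeric[OF qC k(1) z_def \<rho>0 \<rho>1 Q_def, of T] by (auto simp: T_def \<kappa>_def \<eta>_def)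
  define B where "B = (q - 1) * b"
  have B: "B > 0" "(z - 1) * b = Q * B" using bpos q1 by (auto simp: B_def Q_def)
  have "((q - 1) * M * T)\<^sup>2 \<le> (\<rho> * H)\<^sup>2" using ii q1 M T by (intro power_mono) auto
  also have "\<dots> \<le> \<rho>\<^sup>2 * ((q - 1)\<^sup>2 * (z * (z - 1) * b))" using iii by (simp add: power_mult_distrib mult_left_mono)
  finally have "(q - 1)\<^sup>2 * (M\<^sup>2 * T\<^sup>2) \<le> (q - 1)\<^sup>2 * (\<rho>\<^sup>2 * z * ((z - 1) * b))"
    by (simp add: power_mult_distrib mult_ac)
  then have MT: "M\<^sup>2 * T\<^sup>2 \<le> \<rho>\<^sup>2 * z * Q * B" using q1 B by simp
  then have Mu: "M\<^sup>2 \<le> \<rho>\<^sup>2 * z * Q / T\<^sup>2 * B" using T by (simp add: field_simps)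
  \<comment> \<open>Squares are compared: \<open>M\<^sup>2\<close> is bounded by \<open>MT\<close>,
    and \<open>m\<^sup>2\<close> equals \<open>Q * B\<close>.\<close>
  have "M * m \<le> v * B"
  proof (rule power2_le_imp_le)
    have "(M * m)\<^sup>2 * T\<^sup>2 = (M\<^sup>2 * T\<^sup>2) * m\<^sup>2" by (simp add: power_mult_distrib mult_ac)
    also have "\<dots> \<le> (\<rho>\<^sup>2 * z * Q * B) * m\<^sup>2" using MT by (intro mult_right_mono) auto
    also have "\<dots> = \<rho>\<^sup>2 * z * Q\<^sup>2 * B\<^sup>2" using m B by (simp add: power2_eq_square mult_ac)
    also have "\<dots> \<le> T\<^sup>2 * v\<^sup>2 * B\<^sup>2" using v by (intro mult_right_mono) auto
    finally show "(M * m)\<^sup>2 \<le> (v * B)\<^sup>2" using T by (simp add: power_mult_distrib mult_ac)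
  qed (use v B in auto)
  then have "M\<^sup>2 + M * m \<le> (\<rho>\<^sup>2 * z * Q / T\<^sup>2 + v) * B" using Mu by (simp add: distrib_right)
  then have "\<eta> * (M\<^sup>2 + M * m) \<le> \<eta> * ((\<rho>\<^sup>2 * z * Q / T\<^sup>2 + v) * B)" using \<eta> by (intro mult_left_mono) auto
  also have "\<dots> = \<eta> * (\<rho>\<^sup>2 * z * Q / T\<^sup>2 + v) * B" by simp
  also have "\<dots> < (1 - \<rho> * z) * B" using v(3) B(1) by (rule mult_strict_right_mono)
  finally show False using i by (simp add: B_def mult.commute)
qed

text \<open>Subtracting the mean \<open>d\<close> of \<open>\<phi>\<close> over the vectors outside
  \<open>A\<close> and setting the function to 0 on \<open>A\<close> leads to
  \<open>avoiding_count_zero\<close>. As \<open>d \<ge> 0\<close>, this does not increase the weight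
  of any \<open>k\<close>-space disjoint from \<open>A\<close>.\<close>

lemma avoiding_count:
  assumes A: "subspace A" "dim A = k" and k: "k \<ge> 2" "3 * k \<le> dimension"
    and \<phi>: "scale_invariant \<phi>" "sum \<phi> UNIV \<ge> sum \<phi> A"
  shows "avoid_const (q ^ k) * meet_count k 1 k \<le> real (card {S \<in> meeting k {0} A. sum \<phi> S \<ge> 0})"
proof -
  define d where "d = (sum \<phi> UNIV - sum \<phi> A) / real (card (UNIV - A))"
  define \<psi> where "\<psi> x = (if x \<in> A then 0 else \<phi> x - d)" for x
  have d: "d \<ge> 0" using \<phi> by (simp add: d_def)
  have A0: "0 \<in> A" using A subspace_0 by auto
  have "UNIV - A \<noteq> {}"
  proof
    assume "UNIV - A = {}"
    then have "A = UNIV" by auto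
    then show False using A k by (simp add: dimension_def)
  qed
  then have dc: "d * real (card (UNIV - A)) = sum \<phi> UNIV - sum \<phi> A" by (simp add: d_def card_gt_0_iff)
  have "sum \<psi> UNIV = (\<Sum>x\<in>UNIV - A. \<phi> x - d)"
    by (rule sum.mono_neutral_cong_right) (auto simp: \<psi>_def finite_carrier)
  also have "\<dots> = 0" using dc sum_diff[of UNIV A \<phi>] finite_carrier by (simp add: sum_subtractf mult.commute)
  finally have 1: "sum \<psi> UNIV = 0" .
  have 2: "scale_invariant \<psi>"
  proof -
    have "c *s x \<in> A \<longleftrightarrow> x \<in> A" if "c \<noteq> 0" for c x
    proof
      assume "c *s x \<in> A"
      then have "inverse c *s (c *s x) \<in> A" using A subspace_scale by blast
      then show "x \<in> A" using that by simp
    qed (use A subspace_scale in blast)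
    then show ?thesis using \<phi> A0 by (auto simp: scale_invariant_def \<psi>_def)
  qed
  have "sum \<psi> S \<le> sum \<phi> S" if "S \<in> meeting k {0} A" for S
  proof (rule sum_mono)
    fix x assume "x \<in> S"
    then have "x \<in> A \<Longrightarrow> x = 0" using that by (auto simp: meeting_def)
    then show "\<psi> x \<le> \<phi> x" using d \<phi> by (auto simp: \<psi>_def scale_invariant_def)
  qed
  then have "card {S \<in> meeting k {0} A. sum \<psi> S \<ge> 0} \<le> card {S \<in> meeting k {0} A. sum \<phi> S \<ge> 0}"
    by (intro card_mono) force+
  moreover have "avoid_const (q ^ k) * meet_count k 1 k \<le> real (card {S \<in> meeting k {0} A. sum \<psi> S \<ge> 0})"
    using A k 1 2 by (intro avoiding_count_zero) (auto simp: \<psi>_def)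
  ultimately show ?thesis by linarith
qed

section \<open>Families that contain no star\<close>

lemma meeting_zero: "meeting k {0} {0} = {S. subspace S \<and> dim S = k}"
  by (auto simp: meeting_def subspace_0)

text \<open>For \<open>p\<close> outside a \<open>k\<close>-space \<open>A\<close>, the difference
  counts the \<open>k\<close>-spaces through \<open>p\<close> that meet \<open>A\<close>
  nontrivially. Each contains at least \<open>q - 1\<close> of the \<open>q ^ k - 1\<close> nonzero
  vectors of \<open>A\<close>, and each such vector lies together with \<open>p\<close> on
  \<open>meet_count k 2 0\<close> of the \<open>k\<close>-spaces.\<close>

lemma meet_count_defect:
  assumes k: "k \<ge> 2" "3 * k \<le> dimension"
  shows "meet_count k 1 0 - meet_count k 1 k \<le> (q ^ k - 1) / (q - 1) * meet_count k 2 0"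
proof -
  let ?K = "meeting k {0} {0}"
  have "k \<le> dim (UNIV :: 'b set)" using k by (simp add: dimension_def)
  then obtain A where A: "subspace A" "dim A = k"
    using choose_subspace_of_subspace[of k UNIV] by metis
  obtain p where p: "p \<notin> A"
  proof -
    have "A \<noteq> UNIV" using A k by (auto simp: dimension_def)
    then show thesis using that by auto
  qed
  then have p0: "p \<noteq> 0" using A subspace_0 by auto
  define \<psi> where "\<psi> x = (of_bool (x \<in> A - {0}) :: real)" for x
  have \<psi>S: "sum \<psi> S = real (card (S \<inter> A - {0}))" for S
  proof -
    have "real (card (S \<inter> A - {0})) = (\<Sum>x\<in>S. of_bool (x \<in> S \<inter> A - {0}))"
      by (rule real_card_eq_sum) auto
    then show ?thesis unfolding \<psi>_def by (auto intro!: sum.cong)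
  qed
  have "span {p} \<inter> A - {0} = {}"
  proof -
    have "x = 0" if x: "x \<in> span {p}" "x \<in> A" for x
    proof -
      obtain c where c: "x = c *s p" using x by (auto simp: span_singleton)
      have "c = 0"
      proof (rule ccontr)
        assume "c \<noteq> 0"
        then have "p = inverse c *s x" using c by simp
        then show False using p A x subspace_scale by blast
      qed
      then show ?thesis using c by simp
    qed
    then show ?thesis by auto
  qed
  then have "sum \<psi> (span {p}) = 0" using \<psi>S[of "span {p}"] by simp
  moreover have "sum \<psi> UNIV = q ^ k - 1" using \<psi>S[of UNIV] card_minus_zero[OF A(1)] A by simp
  ultimately have e: "(\<Sum>S | S \<in> ?K \<and> p \<in> S. sum \<psi> S) = meet_count k 2 0 * (q ^ k - 1)"
    using sum_meeting_through[of "{0}" "{0}" 0 0 p \<psi> k] p0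
    by (simp add: numeral_2_eq_2 insert_commute[of p 0])
  have "meet_count k 1 0 - meet_count k 1 k =
      real (card {S \<in> ?K. p \<in> S}) - real (card {S \<in> meeting k {0} A. p \<in> S})"
    using card_meeting_through[of "{0}" "{0}" 0 0 p k] card_meeting_through[of "{0}" A 0 k p k] A p p0
    by (simp add: subspace_0)
  also have "\<dots> = real (card ({S \<in> ?K. p \<in> S} - {S \<in> meeting k {0} A. p \<in> S}))"
    by (subst card_Diff_subset) (auto simp: of_nat_diff card_mono meeting_def subspace_0 intro!: of_nat_diff[symmetric] card_mono)
  finally have 1: "meet_count k 1 0 - meet_count k 1 k = real (card ({S \<in> ?K. p \<in> S} - {S \<in> meeting k {0} A. p \<in> S}))" .
  have "(q - 1) * real (card ({S \<in> ?K. p \<in> S} - {S \<in> meeting k {0} A. p \<in> S}))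
      = (\<Sum>S\<in>{S \<in> ?K. p \<in> S} - {S \<in> meeting k {0} A. p \<in> S}. q - 1)" by simp
  also have "\<dots> \<le> (\<Sum>S\<in>{S \<in> ?K. p \<in> S} - {S \<in> meeting k {0} A. p \<in> S}. sum \<psi> S)"
  proof (rule sum_mono)
    fix S assume S: "S \<in> {S \<in> ?K. p \<in> S} - {S \<in> meeting k {0} A. p \<in> S}"
    then have SA: "subspace (S \<inter> A)" using A by (intro subspace_inter) (auto simp: meeting_def)
    have "S \<inter> A \<noteq> {0}" using S by (auto simp: meeting_def)
    then have "dim (S \<inter> A) \<noteq> 0" using subspace_0[OF SA] by auto
    then have "1 \<le> dim (S \<inter> A)" by linarith
    then have "q ^ 1 \<le> q ^ dim (S \<inter> A)" using q_ge_2 by (intro power_increasing) linarith+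
    then show "q - 1 \<le> sum \<psi> S" using card_minus_zero[OF SA] \<psi>S by simp
  qed
  also have "\<dots> \<le> (\<Sum>S | S \<in> ?K \<and> p \<in> S. sum \<psi> S)"
    by (rule sum_mono2) (auto simp: \<psi>S)
  finally show ?thesis unfolding 1 using e q_ge_2 by (simp add: field_simps)
qed

text \<open>A random \<open>k\<close>-space through \<open>p\<close> has mean weight
  \<open>(1 - \<rho>) * (q - 1) * \<phi> p\<close>, and the second claim says that its variance is
  at most \<open>\<rho> * q * (q - 1)\<close> times the sum of all
  \<open>(\<phi> x)\<^sup>2\<close>. For the proof, the fixed contribution of the multiples of
  \<open>p\<close> is removed, and \<open>second_moment_meeting\<close> is applied to the rest with
  \<open>P = Q = span {p}\<close>.\<close>

lemma second_moment_star:
  assumes k: "k \<ge> 2" "3 * k \<le> dimension"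
    and \<phi>: "scale_invariant \<phi>" "sum \<phi> UNIV = 0" and p: "p \<noteq> 0"
    and \<rho>: "\<rho> = (q ^ k - q) / (q ^ dimension - q)"
  shows "(\<Sum>S | S \<in> meeting k {0} {0} \<and> p \<in> S. sum \<phi> S) = meet_count k 1 0 * ((1 - \<rho>) * (q - 1) * \<phi> p)"
    and "(\<Sum>S | S \<in> meeting k {0} {0} \<and> p \<in> S. (sum \<phi> S)\<^sup>2)
      \<le> meet_count k 1 0 * (\<rho> * q * ((q - 1) * (\<Sum>x\<in>UNIV. (\<phi> x)\<^sup>2)) + ((1 - \<rho>) * (q - 1) * \<phi> p)\<^sup>2)"
proof -
  let ?K = "meeting k {0} {0}"
  let ?e = "(q - 1) * \<phi> p"
  define X where "X = meet_count k 1 0"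
  define c where "c = meet_count k 2 0"
  define c3 where "c3 = meet_count k 3 0"
  define a where "a = (\<Sum>x\<in>UNIV. (\<phi> x)\<^sup>2)"
  have z: "q ^ k > q" using q_power_ge[OF k(1)] by simp
  have N: "q ^ dimension \<ge> q ^ k" using k q_ge_2 by (intro power_increasing) auto
  have c: "c = \<rho> * X" using meet_count_ratio(1)[OF k, of 0] by (simp add: c_def X_def \<rho>)
  have X0: "X \<ge> 0" using meet_count_nonneg[of k 0] k by (simp add: X_def)
  have c30: "c3 \<ge> 0" using meet_count_nonneg[of k 0] k by (simp add: c3_def)
  have \<rho>0: "\<rho> \<ge> 0" using z N by (simp add: \<rho>)
  \<comment> \<open>The recursion one dimension higher gives the quotient with
    \<open>q\<^sup>2\<close> in place of \<open>q\<close>. Subtracting more from both terms of a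
    fraction that is at most 1 does not increase it.\<close>
  have c3: "c3 \<le> \<rho> * c"
  proof -
    have q2: "q\<^sup>2 > q" using q_power_ge(3)[of 2] by simp
    have N2: "q ^ dimension > q\<^sup>2" using k q_ge_2 by (intro power_strict_increasing) auto
    have k2: "q ^ k \<ge> q\<^sup>2" using q_power_ge[OF k(1)] by simp
    have "(q ^ k - q\<^sup>2) * c = (q ^ dimension - q\<^sup>2) * c3"
      using meet_count_rec[of 2 k 0] k by (simp add: c_def c3_def numeral_3_eq_3 numeral_2_eq_2 mult.commute)
    then have e: "c3 = (q ^ k - q\<^sup>2) / (q ^ dimension - q\<^sup>2) * c" using N2 by (simp add: field_simps)
    have "(q ^ k - q\<^sup>2) / (q ^ dimension - q\<^sup>2) \<le> \<rho>"
    proof -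
      have "(q ^ k - q\<^sup>2) * (q ^ dimension - q) \<le> (q ^ k - q) * (q ^ dimension - q\<^sup>2)"
      proof -
        have "0 \<le> (q\<^sup>2 - q) * (q ^ dimension - q ^ k)" using q2 N by (intro mult_nonneg_nonneg) auto
        then show ?thesis by (simp add: algebra_simps)
      qed
      then show ?thesis unfolding \<rho> using N2 q2 by (simp add: divide_simps)
    qed
    moreover have "c \<ge> 0" using c X0 \<rho>0 by simp
    ultimately show ?thesis unfolding e by (rule mult_right_mono)
  qed
  have \<rho>1: "\<rho> \<le> 1" using z N by (simp add: \<rho>)
  have cc: "c3 \<le> c" using c3 c X0 \<rho>0 \<rho>1 mult_right_mono[of \<rho> 1 c] by simp
  have sp: "sum \<phi> (span {p}) = ?e" using sum_span_singleton[OF \<phi>(1)] .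
  have W: "(\<Sum>S | S \<in> ?K \<and> p \<in> S. sum \<phi> S) = X * ?e - c * ?e"
    using sum_meeting_through[of "{0}" "{0}" 0 0 p \<phi> k] p \<phi> sp
    by (simp add: numeral_2_eq_2 insert_commute[of p 0] X_def c_def)
  also have W': "\<dots> = X * ((1 - \<rho>) * ?e)" by (simp add: c algebra_simps)
  finally show "(\<Sum>S | S \<in> ?K \<and> p \<in> S. sum \<phi> S) = meet_count k 1 0 * ((1 - \<rho>) * (q - 1) * \<phi> p)"
    by (simp add: X_def mult.assoc)
  have card: "real (card {S \<in> ?K. p \<in> S}) = X"
    using card_meeting_through[of "{0}" "{0}" 0 0 p k] p by (simp add: X_def)
  define P where "P = span {p}"
  have P: "subspace P" "dim P = 1" using p by (simp_all add: P_def dim_insert)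
  have KP: "{S \<in> ?K. p \<in> S} = meeting k P P"
    using meeting_insert[of "{0}" "{0}" p k] p by (simp add: P_def insert_commute[of p 0])
  define \<psi> where "\<psi> x = (if x \<in> P then 0 else \<phi> x)" for x
  have \<psi>S: "sum \<psi> S = sum \<phi> S - ?e" if "P \<subseteq> S" for S
  proof -
    have "sum \<psi> S = sum \<phi> (S - P)"
      by (rule sum.mono_neutral_cong_right) (auto simp: \<psi>_def)
    then show ?thesis using that sp by (simp add: sum_diff P_def)
  qed
  have T: "(\<Sum>x\<in>UNIV. \<psi> x * sum \<psi> (span (insert x P))) \<le> q * ((q - 1) * a)"
  proof -
    have "(\<Sum>x\<in>UNIV. \<psi> x * sum \<psi> (span (insert x P))) \<le> q * (q - 1) * (\<Sum>x\<in>UNIV. (\<psi> x)\<^sup>2)"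
      using sum_cosets_le[of P \<psi>] P by (simp add: \<psi>_def)
    also have "\<dots> \<le> q * (q - 1) * a"
      unfolding a_def using q_ge_2 by (intro mult_left_mono sum_mono) (auto simp: \<psi>_def)
    finally show ?thesis by (simp add: mult.assoc)
  qed
  have a0: "a \<ge> 0" by (auto simp: a_def intro: sum_nonneg)
  define t where "t = (\<Sum>x\<in>UNIV. \<psi> x * sum \<psi> (span (insert x P)))"
  have \<psi>P: "\<psi> x = 0" if "x \<in> P" for x using that by (simp add: \<psi>_def)
  have \<psi>U: "sum \<psi> UNIV = - ?e" using \<psi>S[of UNIV] \<phi> by simp
  have "(\<Sum>S\<in>meeting k P P. (sum \<psi> S)\<^sup>2) = c * t + c3 * ((sum \<psi> UNIV)\<^sup>2 - t)"
    using second_moment_meeting[of P P 1 0 \<psi> k] P \<psi>P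
    by (simp add: t_def c_def c3_def numeral_2_eq_2 numeral_3_eq_3)
  also have "\<dots> = (c - c3) * t + c3 * ?e\<^sup>2"
    unfolding \<psi>U power2_minus by (simp add: left_diff_distrib right_diff_distrib)
  \<comment> \<open>The coset bound for \<open>t\<close> may be inserted because
    \<open>c - c3\<close> is nonnegative.\<close>
  also have "\<dots> \<le> (c - c3) * (q * ((q - 1) * a)) + \<rho> * c * ?e\<^sup>2"
    using T cc c3 by (intro add_mono mult_left_mono mult_right_mono) (auto simp: t_def)
  also have "\<dots> \<le> c * (q * ((q - 1) * a)) + \<rho> * c * ?e\<^sup>2"
    using c30 a0 q_ge_2 by (intro add_right_mono mult_right_mono) auto
  finally have V: "(\<Sum>S\<in>meeting k P P. (sum \<psi> S)\<^sup>2) \<le> c * (q * ((q - 1) * a)) + \<rho> * c * ?e\<^sup>2" .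
  have "(\<Sum>S\<in>meeting k P P. (sum \<psi> S)\<^sup>2) = (\<Sum>S\<in>meeting k P P. (sum \<phi> S)\<^sup>2 - 2 * ?e * sum \<phi> S + ?e\<^sup>2)"
  proof (intro sum.cong refl)
    fix S assume "S \<in> meeting k P P"
    then have "P \<subseteq> S" by (auto simp: meeting_def)
    then show "(sum \<psi> S)\<^sup>2 = (sum \<phi> S)\<^sup>2 - 2 * ?e * sum \<phi> S + ?e\<^sup>2"
      unfolding \<psi>S[OF \<open>P \<subseteq> S\<close>] by (simp add: power2_diff)
  qed
  also have "\<dots> = (\<Sum>S\<in>meeting k P P. (sum \<phi> S)\<^sup>2) - 2 * ?e * (\<Sum>S\<in>meeting k P P. sum \<phi> S) + X * ?e\<^sup>2"
    using card by (simp add: sum.distrib sum_subtractf sum_distrib_left KP)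
  also have "(\<Sum>S\<in>meeting k P P. sum \<phi> S) = X * ((1 - \<rho>) * ?e)" using W W' by (simp add: KP)
  finally have "(\<Sum>S\<in>meeting k P P. (sum \<phi> S)\<^sup>2) \<le>
      c * (q * ((q - 1) * a)) + \<rho> * c * ?e\<^sup>2 + 2 * ?e * (X * ((1 - \<rho>) * ?e)) - X * ?e\<^sup>2" using V by linarith
  \<comment> \<open>With \<open>c = \<rho> * X\<close>, the coefficient of
    \<open>X * ?e\<^sup>2\<close> is
    \<open>\<rho>\<^sup>2 + 2 * (1 - \<rho>) - 1 = (1 - \<rho>)\<^sup>2\<close>.\<close>
  also have "\<dots> = X * (\<rho> * q * ((q - 1) * a) + ((1 - \<rho>) * ?e)\<^sup>2)"
    by (simp add: c power2_eq_square algebra_simps)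
  finally show "(\<Sum>S | S \<in> ?K \<and> p \<in> S. (sum \<phi> S)\<^sup>2)
      \<le> meet_count k 1 0 * (\<rho> * q * ((q - 1) * (\<Sum>x\<in>UNIV. (\<phi> x)\<^sup>2)) + ((1 - \<rho>) * (q - 1) * \<phi> p)\<^sup>2)"
    by (simp add: KP X_def a_def mult.assoc)
qed

text \<open>The strict inequality serves both claims of the theorem: without a star the bound holds,
  and equality is impossible.\<close>

lemma many_nonneg_without_star:
  assumes k: "k \<ge> 2" "3 * k \<le> dimension"
    and \<phi>: "scale_invariant \<phi>" "sum \<phi> UNIV = 0"
    and no_star: "\<And>p. p \<noteq> 0 \<Longrightarrow> \<exists>A. subspace A \<and> dim A = k \<and> p \<in> A \<and> sum \<phi> A < 0"
  shows "meet_count k 1 0 < real (card {S. subspace S \<and> dim S = k \<and> sum \<phi> S \<ge> 0})"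
proof (rule ccontr)
  define z where "z = q ^ k"
  define K where "K = meeting k {0} {0}"
  define F where "F = {S \<in> K. sum \<phi> S \<ge> 0}"
  define X where "X = meet_count k 1 0"
  define l where "l = meet_count k 1 k"
  define c where "c = meet_count k 2 0"
  define \<rho> where "\<rho> = (z - q) / (q ^ dimension - q)"
  define \<theta> where "\<theta> = l / X"
  define \<eta> where "\<eta> = avoid_const z"
  define \<kappa> where "\<kappa> = (z - 1) * (z - q) * \<rho> / ((q - 1) * (q\<^sup>2 - 1))"
  define Q where "Q = (z - 1) / (q - 1)"
  define B where "B = (q - 1) * (\<Sum>x\<in>UNIV. (\<phi> x)\<^sup>2)"
  define w where "w = 1 - \<eta> * \<theta>"
  have F_eq: "F = {S. subspace S \<and> dim S = k \<and> sum \<phi> S \<ge> 0}"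
    by (auto simp: F_def K_def meeting_zero)
  assume "\<not> ?thesis"
  then have small: "real (card F) \<le> X" by (simp add: F_eq X_def)
  have \<phi>0: "\<phi> 0 = 0" using \<phi> by (simp add: scale_invariant_def)
  have q1: "q - 1 > 0" "q > 0" using q_ge_2 by auto
  have q21: "q\<^sup>2 - 1 > 0" using q_power_ge(3)[of 2] q_ge_2 by simp
  have z: "z \<ge> 4" "z > q" "z \<ge> q\<^sup>2" using q_power_ge[OF k(1)] by (auto simp: z_def)
  have X: "X > 0" using meet_count_pos[of k 0 1] k by (simp add: X_def)
  have l: "l > 0" using meet_count_pos[of k k 1] k by (simp add: l_def)
  have c: "c = \<rho> * X" using meet_count_ratio(1)[OF k, of 0] by (simp add: c_def X_def \<rho>_def z_def)
  have N: "z ^ 3 \<le> q ^ dimension"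
    unfolding z_def power_mult[symmetric] using k q_ge_2 by (intro power_increasing) auto
  have z3: "z ^ 1 < z ^ 3" using z by (intro power_strict_increasing) auto
  have \<rho>0: "0 \<le> \<rho>" unfolding \<rho>_def using N z3 z by simp
  have \<rho>1: "\<rho> \<le> (z - q) / (z ^ 3 - q)" unfolding \<rho>_def using N z3 z by (intro frac_le) auto
  have \<rho>2: "\<rho> < 1" unfolding \<rho>_def using N z3 z by simp
  have \<eta>: "0 \<le> \<eta>" "\<eta> \<le> 1" by (auto simp: \<eta>_def avoid_const_def)
  have \<theta>: "1 - Q * \<rho> \<le> \<theta>"
  proof -
    have "X - l \<le> Q * \<rho> * X"
      using meet_count_defect[OF k, folded X_def l_def c_def z_def, folded Q_def] by (simp add: c mult.assoc)
    then have "(1 - Q * \<rho>) * X \<le> l" by (simp add: algebra_simps)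
    then show ?thesis using X by (simp add: \<theta>_def pos_le_divide_eq)
  qed
  have qC: "q = real CARD('a)" "CARD('a) \<ge> 2" using q_def q_ge_2 by auto
  note num = star_numeric[OF qC k(1) z_def \<rho>0 \<rho>1 Q_def \<kappa>_def \<theta>]
  have lX: "l = \<theta> * X" using X by (simp add: \<theta>_def)
  have Q0: "Q \<ge> 0" using z q1 by (simp add: Q_def)
  have \<kappa>0: "\<kappa> \<ge> 0" using z q1 q21 \<rho>0 by (auto simp: \<kappa>_def intro!: divide_nonneg_nonneg mult_nonneg_nonneg)

  \<comment> \<open>The nonnegative \<open>k\<close>-spaces disjoint from a negative
    \<open>A\<close> through \<open>p\<close> all miss \<open>p\<close>. There are at least
    \<open>\<eta> * l\<close> of them, and \<open>F\<close> has at most \<open>X\<close>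
    members.\<close>
  have deg: "real (card {S \<in> F. p \<in> S}) \<le> w * X" if p: "p \<noteq> 0" for p
  proof -
    obtain A where A: "subspace A" "dim A = k" "p \<in> A" "sum \<phi> A < 0" using no_star[OF p] by blast
    let ?G = "{S \<in> meeting k {0} A. sum \<phi> S \<ge> 0}"
    have "\<eta> * l \<le> real (card ?G)"
      using avoiding_count[OF A(1,2) k \<phi>(1)] A \<phi> by (simp add: \<eta>_def l_def z_def)
    moreover have "?G \<inter> {S \<in> F. p \<in> S} = {}" using A p by (auto simp: meeting_def)
    then have "real (card ?G) + real (card {S \<in> F. p \<in> S}) = real (card (?G \<union> {S \<in> F. p \<in> S}))"
      by (simp add: card_Un_disjoint)
    moreover have "?G \<union> {S \<in> F. p \<in> S} \<subseteq> F" by (auto simp: F_eq meeting_def)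
    then have "card (?G \<union> {S \<in> F. p \<in> S}) \<le> card F" by (intro card_mono) auto
    ultimately show ?thesis using small by (simp add: w_def lX algebra_simps)
  qed
  obtain p0 :: 'b where p0: "p0 \<noteq> 0"
  proof -
    have "dim (UNIV :: 'b set) \<noteq> 0" using k by (auto simp: dimension_def)
    then show thesis using that by (metis UNIV_I dim_eq_0 singletonI subsetI)
  qed
  obtain A0 where A0: "A0 \<in> K" "sum \<phi> A0 < 0" using no_star[OF p0] by (auto simp: K_def meeting_zero)
  have Kne: "K \<noteq> {}" using A0 by auto
  have B: "B > 0"
  proof (rule ccontr)
    assume "\<not> B > 0"
    then have "(\<Sum>x\<in>UNIV. (\<phi> x)\<^sup>2) \<le> 0" using q1 by (simp add: B_def zero_less_mult_iff)
    then have "(\<Sum>x\<in>UNIV. (\<phi> x)\<^sup>2) = 0" by (intro antisym sum_nonneg) auto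
    then have "\<phi> x = 0" for x using finite_carrier by (simp add: sum_nonneg_eq_0_iff)
    then show False using A0 by simp
  qed
  obtain C where C: "C \<in> K" "\<And>S. S \<in> K \<Longrightarrow> sum \<phi> S \<le> sum \<phi> C"
    using finite_maximizer[OF Kne, of "sum \<phi>"] by blast
  obtain D where D: "D \<in> K" "\<And>S. S \<in> K \<Longrightarrow> - sum \<phi> S \<le> - sum \<phi> D"
    using finite_maximizer[OF Kne, of "\<lambda>S. - sum \<phi> S"] by blast
  have Cs: "subspace C" "dim C = k" using C by (auto simp: K_def meeting_zero)
  have Ds: "subspace D" "dim D = k" using D by (auto simp: K_def meeting_zero)
  define M where "M = sum \<phi> C"
  define m where "m = - sum \<phi> D"
  have m0: "m \<ge> 0" using D(2)[OF A0(1)] A0(2) by (simp add: m_def)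
  have WK: "(\<Sum>S\<in>K. sum \<phi> S) = 0"
    using sum_meeting[of "{0}" "{0}" 0 0 \<phi> k] \<phi> \<phi>0 by (simp add: K_def)
  have M0: "M \<ge> 0"
  proof -
    have "0 \<le> real (card K) * M"
      using sum_bounded_above[of K "sum \<phi>" M] C WK by (simp add: M_def)
    then show ?thesis using Kne by (simp add: zero_le_mult_iff card_gt_0_iff)
  qed
  have second: "X * (1 - \<rho>) * B \<le> (M + m) * M * X"
  proof -
    have "(\<Sum>x\<in>UNIV. \<phi> x * sum \<phi> (span (insert x {0}))) = B"
      using sum_span_singleton[OF \<phi>(1)]
      by (simp add: insert_commute[of _ 0] B_def sum_distrib_left power2_eq_square mult_ac)
    then have "(\<Sum>S\<in>K. (sum \<phi> S)\<^sup>2) = X * B - c * B"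
      using second_moment_meeting[of "{0}" "{0}" 0 0 \<phi> k] \<phi> \<phi>0
      by (simp add: K_def X_def c_def numeral_2_eq_2)
    then have "X * (1 - \<rho>) * B = (\<Sum>S\<in>K. (sum \<phi> S)\<^sup>2)" by (simp add: c algebra_simps)
    also have "\<dots> \<le> (M + m) * M * real (card F)"
      unfolding F_def using C D M0 m0 by (intro second_moment_le WK) (auto simp: M_def m_def)
    also have "\<dots> \<le> (M + m) * M * X" using small M0 m0 by (intro mult_left_mono) auto
    finally show ?thesis .
  qed
  have M: "M > 0"
  proof (rule ccontr)
    assume "\<not> M > 0"
    then have "M = 0" using M0 by simp
    then have "X * (1 - \<rho>) * B \<le> 0" using second by simp
    moreover have "X * (1 - \<rho>) * B > 0" using X B \<rho>2 by simp
    ultimately show False by simp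
  qed
  \<comment> \<open>The total weight of the \<open>k\<close>-spaces disjoint from the minimizer
    \<open>D\<close> is exactly \<open>l * m\<close>, since the vectors outside \<open>D\<close> sum
    to \<open>m\<close>. It is at most \<open>M\<close> for each nonnegative member.\<close>
  have mM: "m \<le> M / \<theta>"
  proof -
    have "l * m = (\<Sum>S\<in>meeting k {0} D. sum \<phi> S)"
      using sum_meeting[of "{0}" D 0 k \<phi> k] Ds \<phi> \<phi>0 by (simp add: subspace_0 l_def m_def)
    also have "\<dots> \<le> (\<Sum>S\<in>meeting k {0} D. if S \<in> F then M else 0)"
      using C by (intro sum_mono) (auto simp: F_def K_def M_def meeting_def subspace_0)
    also have "\<dots> = real (card (meeting k {0} D \<inter> F)) * M" by (simp add: sum.If_cases)
    also have "\<dots> \<le> real (card F) * M" using M by (intro mult_right_mono) (auto intro!: card_mono)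
    also have "\<dots> \<le> X * M" using small M by (intro mult_right_mono) auto
    finally have "X * (\<theta> * m) \<le> X * M" by (simp add: lX mult_ac)
    then have "\<theta> * m \<le> M" using X by simp
    then show ?thesis using num(1) by (simp add: pos_le_divide_eq mult.commute)
  qed
  have BM: "(1 - \<rho>) * B \<le> M\<^sup>2 * (1 + 1 / \<theta>)"
  proof -
    have "X * ((1 - \<rho>) * B) \<le> X * ((M + m) * M)" using second by (simp add: mult_ac)
    then have "(1 - \<rho>) * B \<le> (M + m) * M" using X by simp
    also have "\<dots> \<le> (M + M / \<theta>) * M" using mM M by (intro mult_right_mono) auto
    finally show ?thesis by (simp add: power2_eq_square algebra_simps)
  qed

  \<comment> \<open>\<open>G\<close> bounds the variance in the star of a point, \<open>x p\<close>
    is the mean weight there, and \<open>dg p\<close> is the number of nonnegative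
    \<open>k\<close>-spaces through \<open>p\<close>.\<close>
  define G where "G = \<rho> * q * B"
  define x where "x p = (1 - \<rho>) * (q - 1) * \<phi> p" for p
  define dg where "dg p = real (card {S \<in> F. p \<in> S})" for p
  define P where "P = {p \<in> C - {0}. \<phi> p > 0}"
  define s where "s = sum x P"
  have G0: "G \<ge> 0" using \<rho>0 q1 B by (simp add: G_def)
  \<comment> \<open>Discarding the negative \<open>k\<close>-spaces through \<open>p\<close> only
    increases the sum of weights. The remaining sum is bounded once by the maximum and the degree,
    and once by the Cauchy-Schwarz inequality and the second moment.\<close>
  have xp: "0 < x p \<and> x p \<le> M * w \<and> (x p)\<^sup>2 \<le> dg p / X * (G + (x p)\<^sup>2)" if p: "p \<in> P" for p
  proof -
    have p0: "p \<noteq> 0" using p by (auto simp: P_def)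
    have pos: "x p > 0" using p \<rho>2 q1 by (auto simp: P_def x_def)
    let ?Kp = "{S. S \<in> K \<and> p \<in> S}" and ?Fp = "{S \<in> F. p \<in> S}"
    note sm = second_moment_star[OF k \<phi> p0, of \<rho>, folded K_def X_def z_def, OF \<rho>_def]
    have sub: "?Fp \<subseteq> ?Kp" by (auto simp: F_def)
    have 1: "X * x p \<le> (\<Sum>S\<in>?Fp. sum \<phi> S)"
    proof -
      have "X * x p = (\<Sum>S\<in>?Kp. sum \<phi> S)" using sm(1) by (simp add: x_def)
      also have "\<dots> = (\<Sum>S\<in>?Fp. sum \<phi> S) + (\<Sum>S\<in>?Kp - ?Fp. sum \<phi> S)"
        using sub by (subst sum.subset_diff[of ?Fp]) auto
      also have "(\<Sum>S\<in>?Kp - ?Fp. sum \<phi> S) \<le> 0" by (rule sum_nonpos) (auto simp: F_def)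
      finally show ?thesis by simp
    qed
    also have "\<dots> \<le> dg p * M"
      using sum_bounded_above[of ?Fp "sum \<phi>" M] C by (auto simp: F_def M_def dg_def)
    also have "\<dots> \<le> w * X * M" using deg[OF p0] M by (intro mult_right_mono) (auto simp: dg_def)
    finally have "X * x p \<le> X * (M * w)" by (simp add: mult_ac)
    then have A: "x p \<le> M * w" using X by simp
    have "(X * x p)\<^sup>2 \<le> (\<Sum>S\<in>?Fp. 1 * sum \<phi> S)\<^sup>2" using 1 pos X by (intro power_mono) auto
    also have "\<dots> \<le> (\<Sum>S\<in>?Fp. 1\<^sup>2) * (\<Sum>S\<in>?Fp. (sum \<phi> S)\<^sup>2)" by (rule Cauchy_Schwarz_ineq_sum)
    also have "(\<Sum>S\<in>?Fp. 1\<^sup>2) = dg p" by (simp add: dg_def)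
    also have "dg p * (\<Sum>S\<in>?Fp. (sum \<phi> S)\<^sup>2) \<le> dg p * (\<Sum>S\<in>?Kp. (sum \<phi> S)\<^sup>2)"
      using sub by (intro mult_left_mono sum_mono2) (auto simp: dg_def)
    also have "\<dots> \<le> dg p * (X * (G + (x p)\<^sup>2))"
      using sm(2) by (intro mult_left_mono) (auto simp: G_def B_def x_def dg_def)
    finally have "X * (X * (x p)\<^sup>2) \<le> X * (dg p * (G + (x p)\<^sup>2))" by (simp add: power2_eq_square mult_ac)
    then have "X * (x p)\<^sup>2 \<le> dg p * (G + (x p)\<^sup>2)" using X by simp
    then have "(x p)\<^sup>2 \<le> dg p * (G + (x p)\<^sup>2) / X" using X by (simp add: pos_le_divide_eq mult.commute)
    then show ?thesis using pos A by simp
  qed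
  define s0 where "s0 = (1 - \<rho>) * (q - 1) * M"
  have s0: "0 < s0" using \<rho>2 q1 M by (simp add: s0_def)
  have s0s: "s0 \<le> s"
  proof -
    have "sum \<phi> C = sum \<phi> (C - {0})" using \<phi>0 by (intro sum.mono_neutral_right) auto
    also have "\<dots> = sum \<phi> P + sum \<phi> ((C - {0}) - P)"
      by (subst sum.subset_diff[of P]) (auto simp: P_def)
    also have "sum \<phi> ((C - {0}) - P) \<le> 0" by (rule sum_nonpos) (auto simp: P_def)
    finally have "M \<le> sum \<phi> P" by (simp add: M_def)
    then have "(1 - \<rho>) * (q - 1) * M \<le> (1 - \<rho>) * (q - 1) * sum \<phi> P"
      using \<rho>2 q1 by (intro mult_left_mono) auto
    then show ?thesis by (simp add: s0_def s_def x_def sum_distrib_left)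
  qed
  \<comment> \<open>The degrees along \<open>C\<close> count common nonzero vectors of
    \<open>C\<close> and nonnegative \<open>k\<close>-spaces, so \<open>meeting_common_card\<close>
    applies with \<open>A = {0}\<close>.\<close>
  have dgsum: "(\<Sum>p\<in>P. dg p / X) \<le> (q - 1) * (1 + \<kappa>)"
  proof -
    have "(\<Sum>p\<in>P. dg p) \<le> (\<Sum>p\<in>C - {0}. dg p)" by (rule sum_mono2) (auto simp: P_def dg_def)
    also have "\<dots> = (\<Sum>p\<in>UNIV. of_bool (p \<in> C - {0}) * dg p)"
      by (rule sum.mono_neutral_cong_left) (auto simp: finite_carrier)
    also have "\<dots> = (\<Sum>S\<in>F. \<Sum>p\<in>S. of_bool (p \<in> C - {0}))" by (simp only: sum_incidence dg_def)
    also have "\<dots> = (\<Sum>S\<in>F. real (card (S \<inter> C)) - 1)"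
    proof (intro sum.cong refl)
      fix S assume "S \<in> F"
      then have "subspace (S \<inter> C)" using Cs by (intro subspace_inter) (auto simp: F_eq)
      then have "real (card (S \<inter> C)) - 1 = real (card (S \<inter> C - {0}))" by (simp add: card_minus_zero card_subspace)
      also have "\<dots> = (\<Sum>x\<in>S. of_bool (x \<in> S \<inter> C - {0}))" by (rule real_card_eq_sum) auto
      also have "\<dots> = (\<Sum>x\<in>S. of_bool (x \<in> C - {0}))" by (intro sum.cong refl) auto
      finally show "(\<Sum>p\<in>S. of_bool (p \<in> C - {0})) = real (card (S \<inter> C)) - 1" by simp
    qed
    also have "\<dots> \<le> (q - 1) * real (card F) + (z - 1) * (z - q) * c / (q\<^sup>2 - 1)"
      using meeting_common_card[of "{0}" C k F 0] C by (simp add: K_def F_def z_def c_def)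
    also have "(z - 1) * (z - q) * c / (q\<^sup>2 - 1) = (q - 1) * \<kappa> * X"
      using q1 by (simp add: \<kappa>_def c)
    also have "(q - 1) * real (card F) + (q - 1) * \<kappa> * X \<le> (q - 1) * X + (q - 1) * \<kappa> * X"
      using small q1 by (intro add_right_mono mult_left_mono) auto
    finally have "(\<Sum>p\<in>P. dg p) \<le> (q - 1) * (1 + \<kappa>) * X" by (simp add: algebra_simps)
    then show ?thesis using X by (simp add: pos_divide_le_eq flip: sum_divide_distrib)
  qed
  have xsum: "(\<Sum>p\<in>P. G + (x p)\<^sup>2) \<le> (q - 1) * Q * G + M * w * s"
  proof -
    have "(\<Sum>p\<in>P. (x p)\<^sup>2) \<le> (\<Sum>p\<in>P. M * w * x p)"
      using xp by (intro sum_mono) (auto simp: power2_eq_square intro!: mult_right_mono)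
    moreover have "real (card P) \<le> z - 1"
    proof -
      have "real (card P) \<le> real (card (C - {0}))" by (auto simp: P_def intro!: card_mono)
      then show ?thesis using card_minus_zero[OF Cs(1)] Cs by (simp add: z_def)
    qed
    then have "real (card P) * G \<le> (z - 1) * G" using G0 by (rule mult_right_mono)
    moreover have "(q - 1) * Q = z - 1" using q1 by (simp add: Q_def)
    ultimately show ?thesis by (simp add: sum.distrib s_def sum_distrib_left)
  qed
  \<comment> \<open>The pointwise bounds are combined by a second use of the Cauchy-Schwarz
    inequality, which separates the degrees from the second moments.\<close>
  have "s\<^sup>2 \<le> (\<Sum>p\<in>P. sqrt (dg p / X) * sqrt (G + (x p)\<^sup>2))\<^sup>2"
  proof (rule power_mono)
    show "0 \<le> s" using s0 s0s by simp
    have "x p \<le> sqrt (dg p / X) * sqrt (G + (x p)\<^sup>2)" if "p \<in> P" for p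
      using xp[OF that] by (simp add: real_le_rsqrt flip: real_sqrt_mult)
    then show "s \<le> (\<Sum>p\<in>P. sqrt (dg p / X) * sqrt (G + (x p)\<^sup>2))"
      unfolding s_def by (rule sum_mono)
  qed
  also have "\<dots> \<le> (\<Sum>p\<in>P. (sqrt (dg p / X))\<^sup>2) * (\<Sum>p\<in>P. (sqrt (G + (x p)\<^sup>2))\<^sup>2)"
    by (rule Cauchy_Schwarz_ineq_sum)
  also have "\<dots> = (\<Sum>p\<in>P. dg p / X) * (\<Sum>p\<in>P. G + (x p)\<^sup>2)"
    using X G0 by (simp add: dg_def)
  also have "\<dots> \<le> ((q - 1) * (1 + \<kappa>)) * ((q - 1) * Q * G + M * w * s)"
    using dgsum xsum G0 q1 \<kappa>0 by (intro mult_mono) (auto intro!: sum_nonneg)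
  finally have "s\<^sup>2 \<le> (q - 1)\<^sup>2 * (1 + \<kappa>) * Q * G + (q - 1) * (1 + \<kappa>) * M * w * s"
    by (simp add: algebra_simps power2_eq_square)
  \<comment> \<open>Passing from \<open>s\<close> to \<open>s0\<close>, a fixed multiple of
    \<open>M\<close>, makes every term comparable with \<open>M\<^sup>2\<close> once
    \<open>BM\<close> bounds \<open>B\<close>.\<close>
  from quadratic_le_at_smaller[OF this s0 s0s]
  have "s0\<^sup>2 \<le> (q - 1)\<^sup>2 * (1 + \<kappa>) * Q * G + (q - 1) * (1 + \<kappa>) * M * w * s0"
    using \<kappa>0 Q0 G0 by simp
  then have "(q - 1)\<^sup>2 * ((1 - \<rho>)\<^sup>2 * M\<^sup>2) \<le> (q - 1)\<^sup>2 * ((1 + \<kappa>) * (Q * G + M\<^sup>2 * w * (1 - \<rho>)))"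
    by (simp add: s0_def power2_eq_square algebra_simps)
  then have "(1 - \<rho>)\<^sup>2 * M\<^sup>2 \<le> (1 + \<kappa>) * (Q * G + M\<^sup>2 * w * (1 - \<rho>))" using q1 by simp
  also have "\<dots> \<le> (1 + \<kappa>) * (Q * (\<rho> * q * (M\<^sup>2 * (1 + 1 / \<theta>) / (1 - \<rho>))) + M\<^sup>2 * w * (1 - \<rho>))"
  proof -
    have "B \<le> M\<^sup>2 * (1 + 1 / \<theta>) / (1 - \<rho>)" using BM \<rho>2 by (simp add: pos_le_divide_eq mult.commute)
    then show ?thesis unfolding G_def using \<kappa>0 Q0 \<rho>0 q1
      by (intro mult_left_mono add_right_mono) auto
  qed
  also have "\<dots> = (1 - \<rho>) * M\<^sup>2 * ((1 + \<kappa>) * (Q * \<rho> * q * (1 + 1 / \<theta>) / (1 - \<rho>)\<^sup>2 + w))"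
  proof -
    have "(1 + \<kappa>) * (Q * (\<rho> * q * (y * u / t)) + y * w * t) = t * y * ((1 + \<kappa>) * (Q * \<rho> * q * u / t\<^sup>2 + w))"
      if "t \<noteq> 0" for t u y
      using that by (simp add: power2_eq_square field_simps)
    then show ?thesis using \<rho>2 by simp
  qed
  also have "\<dots> < (1 - \<rho>) * M\<^sup>2 * (1 - \<rho>)"
    using num(2) \<rho>2 M by (intro mult_strict_left_mono) (auto simp: w_def \<eta>_def)
  finally show False by (simp add: power2_eq_square mult_ac)
qed

section \<open>From vectors to one-dimensional subspaces\<close>

definition vector_weight :: "('b set \<Rightarrow> real) \<Rightarrow> 'b \<Rightarrow> real" where
  "vector_weight f x = (if x = 0 then 0 else f (span {x}))"

lemma span_singleton_eq:
  assumes "subspace L" "dim L = 1" "x \<in> L" "x \<noteq> 0"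
  shows "span {x} = L"
proof (rule subspace_dim_equal)
  show "span {x} \<subseteq> L" using assms by (intro span_minimal) auto
qed (use assms in \<open>auto simp: dim_insert\<close>)

lemma scale_invariant_vector_weight: "scale_invariant (vector_weight f)"
proof -
  have "span {c *s x} = span {x}" if "c \<noteq> 0" "x \<noteq> 0" for c x
    using that by (intro span_singleton_eq) (auto simp: dim_insert intro: span_scale span_base)
  then show ?thesis by (auto simp: scale_invariant_def vector_weight_def)
qed

text \<open>The nonzero vectors of \<open>S\<close> are grouped by the point that they span, and
  each point has \<open>q - 1\<close> of them.\<close>

lemma sum_vector_weight:
  assumes S: "subspace S"
  shows "sum (vector_weight f) S = (q - 1) * subspace_weight scale f S"
proof -
  let ?T = "{L. L \<in> subspaces_of_dim scale 1 \<and> L \<subseteq> S}"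
  have "sum (vector_weight f) S = sum (vector_weight f) (S - {0})"
    by (intro sum.mono_neutral_right) (auto simp: vector_weight_def)
  also have "\<dots> = (\<Sum>L\<in>?T. sum (vector_weight f) {x \<in> S - {0}. span {x} = L})"
  proof (rule sum.group[symmetric])
    show "(\<lambda>x. span {x}) ` (S - {0}) \<subseteq> ?T"
    proof (rule image_subsetI)
      fix x assume "x \<in> S - {0}"
      then show "span {x} \<in> ?T" using S span_minimal[of "{x}" S] by (simp add: subspaces_of_dim_def dim_insert)
    qed
  qed simp_all
  also have "\<dots> = (\<Sum>L\<in>?T. (q - 1) * f L)"
  proof (intro sum.cong refl)
    fix L assume L: "L \<in> ?T"
    then have Ls: "subspace L" "dim L = 1" "L \<subseteq> S" by (auto simp: subspaces_of_dim_def)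
    have "{x \<in> S - {0}. span {x} = L} = L - {0}"
      using span_singleton_eq[OF Ls(1,2)] Ls(3) by (auto intro: span_base)
    then have "sum (vector_weight f) {x \<in> S - {0}. span {x} = L} = (\<Sum>x\<in>L - {0}. f L)"
      using span_singleton_eq[OF Ls(1,2)] by (auto simp: vector_weight_def intro!: sum.cong)
    then show "sum (vector_weight f) {x \<in> S - {0}. span {x} = L} = (q - 1) * f L"
      using card_minus_zero[OF Ls(1)] Ls by simp
  qed
  finally show ?thesis by (simp add: subspace_weight_def sum_distrib_left)
qed

lemma nonneg_subspaces_eq:
  "nonneg_subspaces scale f k = {S. subspace S \<and> dim S = k \<and> sum (vector_weight f) S \<ge> 0}"
  using q_ge_2 by (auto simp: nonneg_subspaces_def subspaces_of_dim_def sum_vector_weight zero_le_mult_iff)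

text \<open>A power \<open>q ^ Suc i\<close> cancels in each factor; the right side is the size of a
  star.\<close>

lemma gauss_binomial_eq_meet_count:
  assumes "1 \<le> k" "k \<le> dimension"
  shows "gauss_binomial CARD('a) (dimension - 1) (k - 1) = meet_count k 1 0"
proof -
  have "meet_count k 1 0 = (\<Prod>i=1..<k. (q ^ dimension - q ^ i) / (q ^ k - q ^ i))"
    using assms by (simp add: meet_count_def)
  also have "\<dots> = (\<Prod>i<k - 1. (q ^ dimension - q ^ Suc i) / (q ^ k - q ^ Suc i))"
    by (rule prod.reindex_bij_witness[of _ Suc "\<lambda>i. i - 1"]) auto
  also have "\<dots> = gauss_binomial CARD('a) (dimension - 1) (k - 1)"
    unfolding gauss_binomial_def
  proof (intro prod.cong refl)
    fix i assume i: "i \<in> {..<k - 1}"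
    have e: "q ^ m - q ^ Suc i = q ^ Suc i * (q ^ (m - 1 - i) - 1)" if "Suc i \<le> m" for m
    proof -
      have "m = Suc i + (m - 1 - i)" using that by simp
      then have "q ^ m = q ^ Suc i * q ^ (m - 1 - i)" by (metis power_add)
      then show ?thesis by (simp add: right_diff_distrib)
    qed
    show "(q ^ dimension - q ^ Suc i) / (q ^ k - q ^ Suc i) =
      (real CARD('a) ^ (dimension - 1 - i) - 1) / (real CARD('a) ^ (k - 1 - i) - 1)"
      using i assms q_ge_2 e[of dimension] e[of k] by (simp add: q_def[symmetric])
  qed
  finally show ?thesis by simp
qed

text \<open>If all \<open>k\<close>-spaces through some nonzero \<open>p\<close> are nonnegative,
  the family contains the star of \<open>p\<close>, and equal finite sizes force equality of sets.
  Otherwise \<open>many_nonneg_without_star\<close> gives strict inequality.\<close>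

lemma manickam_miklos_singhi:
  assumes k: "1 \<le> k" "3 * k \<le> dimension"
    and f: "(\<Sum>v \<in> subspaces_of_dim scale 1. f v) = 0"
  defines "\<F> \<equiv> nonneg_subspaces scale f k"
  shows "meet_count k 1 0 \<le> real (card \<F>) \<and>
    (real (card \<F>) = meet_count k 1 0 \<longrightarrow> (\<exists>v \<in> subspaces_of_dim scale 1. \<F> = star scale k v))"
proof -
  define \<phi> where "\<phi> = vector_weight f"
  have \<phi>: "scale_invariant \<phi>" "sum \<phi> UNIV = 0"
    using scale_invariant_vector_weight sum_vector_weight[OF subspace_UNIV, of f] f
    by (simp_all add: \<phi>_def subspace_weight_def)
  have \<F>: "\<F> = {S. subspace S \<and> dim S = k \<and> sum \<phi> S \<ge> 0}"
    by (simp add: \<F>_def \<phi>_def nonneg_subspaces_eq)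
  have star: ?thesis
    if p: "p \<noteq> 0" and all: "\<And>S. subspace S \<Longrightarrow> dim S = k \<Longrightarrow> p \<in> S \<Longrightarrow> sum \<phi> S \<ge> 0" for p
  proof -
    have "span {p} \<subseteq> S \<longleftrightarrow> p \<in> S" if "subspace S" for S
      using that span_minimal[of "{p}" S] by (auto intro: span_base)
    then have s: "star scale k (span {p}) = {S \<in> meeting k {0} {0}. p \<in> S}"
      by (auto simp: star_def subspaces_of_dim_def meeting_zero)
    have sub: "star scale k (span {p}) \<subseteq> \<F>" unfolding s \<F> using all by (auto simp: meeting_zero)
    have card: "real (card (star scale k (span {p}))) = meet_count k 1 0"
      using card_meeting_through[of "{0}" "{0}" 0 0 p k] p by (simp add: s)
    have "span {p} \<in> subspaces_of_dim scale 1" using p by (simp add: subspaces_of_dim_def dim_insert)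
    moreover have "card (star scale k (span {p})) \<le> card \<F>" using sub by (intro card_mono) auto
    moreover have "\<F> = star scale k (span {p})" if "real (card \<F>) = meet_count k 1 0"
      using card_subset_eq[OF _ sub] that card by simp
    ultimately show ?thesis using card by force
  qed
  show ?thesis
  proof (cases "\<exists>p. p \<noteq> 0 \<and> (\<forall>S. subspace S \<longrightarrow> dim S = k \<longrightarrow> p \<in> S \<longrightarrow> sum \<phi> S \<ge> 0)")
    case True
    then show ?thesis using star by blast
  next
    case False
    \<comment> \<open>For \<open>k = 1\<close> the only \<open>k\<close>-space through
      \<open>p\<close> is its span, so all nonzero vectors would have negative weight, contrary to
      the total 0.\<close>
    have k2: "k \<ge> 2"
    proof (rule ccontr)
      assume "\<not> k \<ge> 2"
      then have k1: "k = 1" using k by simp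
      have "\<phi> p < 0" if "p \<noteq> 0" for p
      proof -
        obtain S where S: "subspace S" "dim S = 1" "p \<in> S" "\<not> sum \<phi> S \<ge> 0"
          using False \<open>p \<noteq> 0\<close> k1 by blast
        then have "(q - 1) * \<phi> p < 0" using span_singleton_eq[of S p] that sum_span_singleton[OF \<phi>(1), of p] by simp
        then show ?thesis using q_ge_2 by (simp add: mult_less_0_iff)
      qed
      moreover have "(UNIV :: 'b set) - {0} \<noteq> {}"
      proof
        assume "(UNIV :: 'b set) - {0} = {}"
        then have "dim (UNIV :: 'b set) = 0" by (subst dim_eq_0) auto
        then have "dimension = 0" unfolding dimension_def by (simp only: dim_UNIV)
        then show False using k by simp
      qed
      ultimately have "sum \<phi> (UNIV - {0}) < 0"
        using sum_strict_mono[of "UNIV - {0}" \<phi> "\<lambda>_. 0"] by simp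
      moreover have "sum \<phi> UNIV = sum \<phi> (UNIV - {0})"
        using \<phi>(1) finite_carrier by (intro sum.mono_neutral_right) (auto simp: scale_invariant_def)
      ultimately show False using \<phi>(2) by simp
    qed
    have "meet_count k 1 0 < real (card \<F>)"
      unfolding \<F> using False by (intro many_nonneg_without_star k2 k \<phi>) (meson not_le)
    then show ?thesis by simp
  qed
qed

end

theorem theorem1p3:
  fixes scale :: "'a::{field,finite} \<Rightarrow> 'b::ab_group_add \<Rightarrow> 'b"
    and Basis :: "'b set"
    and f :: "'b set \<Rightarrow> real"
    and n k :: nat
  assumes "finite_dimensional_vector_space scale Basis"
    and "vector_space.dim scale (UNIV :: 'b set) = n"
    and "(\<Sum>v \<in> subspaces_of_dim scale 1. f v) = 0"
    and "k \<ge> 1"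
    and "n \<ge> 3 * k"
  shows "gauss_binomial CARD('a) (n - 1) (k - 1) \<le> real (card (nonneg_subspaces scale f k))
    \<and> (real (card (nonneg_subspaces scale f k)) = gauss_binomial CARD('a) (n - 1) (k - 1)
        \<longrightarrow> (\<exists>v \<in> subspaces_of_dim scale 1. nonneg_subspaces scale f k = star scale k v))"
proof -
  interpret finite_vector_space scale Basis
    using assms(1) by (rule finite_vector_space.intro)
  have n: "dimension = n" using assms(2) by (simp add: dimension_def)
  show ?thesis
    using manickam_miklos_singhi[of k f] gauss_binomial_eq_meet_count[of k] assms n by simp
qed

end
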